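(* Let $a\ge 1$, let $p=(p_1,\dots,p_a)$ be a probability vector with all $p_s>0$, let $n\ge 2$, and let $\mathcal{B}_n^p$ denote the number of branches of a $p$-biased recursive tree of order $n$. Write $P_s=\sum_{\ell=1}^{s}p_\ell$ and $Q_s=\sum_{\ell=s+1}^{a}p_\ell$. Then $$\begin{aligned} \mathrm{Var}(\mathcal{B}_n^p) ={}& \sum_{s=1}^{a-1} \frac{p_s}{P_s}\left(1-Q_s^{\,n-1}\right) - \sum_{s=1}^{a-1} p_s - \sum_{s=1}^{a-1} p_s^2 Q_s^2\, \frac{1-Q_s^{\,2(n-2)}}{1-Q_s^{2}} \\ &- 2\sum_{s=2}^{a-1}\sum_{r=1}^{s-1} p_s p_r\, Q_sQ_r\, \frac{1-(Q_sQ_r)^{n-2}}{1-Q_sQ_r} + 2\sum_{s=2}^{a-1} \frac{p_s Q_s}{P_s}\sum_{r=1}^{s-1}\frac{p_r}{P_r}\left(1-Q_s^{\,n-3}\right) \\ &- 2\sum_{s=2}^{a-1} p_sQ_s\sum_{r=1}^{s-1}\frac{p_rQ_r}{P_r}\,\frac{1}{\sum_{q=r+1}^{s}p_q}\left(Q_r^{\,n-3}-Q_s^{\,n-3}\right) \\ &- 2\sum_{s=1}^{a-1}p_sQ_s\sum_{r=1}^{a-1}\frac{p_r}{P_r}\,Q_r^2\,\frac{1-(Q_sQ_r)^{n-3}}{1-Q_sQ_r} + 2\sum_{s=1}^{a-1}\frac{p_s}{P_s}Q_s\sum_{r=1}^{a-1}\frac{p_r}{P_r}\,Q_r^{\,n-1}\left(1-Q_s^{\,n-3}\right)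 \end{aligned}$$ and $$\begin{aligned} \mathrm{Var}(\mathcal{B}_n^p) \xrightarrow[n\to\infty]{}{}& \sum_{s=1}^{a-1}\frac{p_s}{P_s} - \sum_{s=1}^{a-1}p_s - \sum_{s=1}^{a-1}p_s^2Q_s^2\,\frac{1}{1-Q_s^2} - 2\sum_{s=2}^{a-1}\sum_{r=1}^{s-1}p_sp_r\,Q_sQ_r\,\frac{1}{1-Q_sQ_r} \\ &+ 2\sum_{s=2}^{a-1}\frac{p_sQ_s}{P_s}\sum_{r=1}^{s-1}\frac{p_r}{P_r} - 2\sum_{s=1}^{a-1}p_sQ_s\sum_{r=1}^{a-1}\frac{p_r}{P_r}\,Q_r^2\,\frac{1}{1-Q_sQ_r}. \end{aligned}$$
   Context: $p$-biased riffle shuffle of $\{2,\dots,n\}$: start with the deck $2,3,\dots,n$ in increasing order; cut it into $a$ consecutive piles whose sizes $(b_1,\dots,b_a)$ (pile 1 consisting of the $b_1$ smallest cards, etc.) have the multinomial$(n-1;p)$ distribution; then choose uniformly one of the $\binom{n-1}{b_1,\dots,b_a}$ ways of interleaving the piles keeping the cards of each pile in their original order. The resulting arrangement $\gamma=(\gamma(2),\dots,\gamma(n))$ is the $p$-biased riffle shuffle permutation of $\{2,\dots,n\}$, where $\gamma(j)$ is the card in position $j$. $p$-biased recursive tree ($p$-BRT) of order $n$: the random rooted tree on vertices $1,\dots,n$ with root $1$, obtained by attaching each node $i\ge 2$ to the rightmost element $j$ of $\gamma$ which precedes $i$ and satisfies $j<i$; if there is no such $j$, the parent of $i$ is $1$.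 The number of branches of a tree is the degree of its root. *)

theory Defs
  imports "HOL-Probability.Probability"
begin

text \<open>
  Piles are indexed by \<open>1, \<dots>, a\<close>, and \<open>p s\<close> is the probability of pile \<open>s\<close>. Size vectors are
  functions on \<open>nat\<close> that are forced to be \<open>0\<close> outside \<open>{1..a}\<close>, so that each vector
  \<open>(b\<^sub>1, \<dots>, b\<^sub>a)\<close> has exactly one representative.
\<close>

definition size_vectors :: "nat \<Rightarrow> nat \<Rightarrow> (nat \<Rightarrow> nat) set" where
  "size_vectors a m = {b. (\<forall>s. s \<notin> {1..a} \<longrightarrow> b s = 0) \<and> (\<Sum>s=1..a. b s) = m}"

definition multinomial_mass :: "nat \<Rightarrow> (nat \<Rightarrow> real) \<Rightarrow> nat \<Rightarrow> (nat \<Rightarrow> nat) \<Rightarrow> real" where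
  "multinomial_mass a p m b =
     (if b \<in> size_vectors a m
      then fact m / (\<Prod>s=1..a. fact (b s)) * (\<Prod>s=1..a. p s ^ b s) else 0)"

definition multinomial_pmf :: "nat \<Rightarrow> (nat \<Rightarrow> real) \<Rightarrow> nat \<Rightarrow> (nat \<Rightarrow> nat) pmf" where
  "multinomial_pmf a p m = embed_pmf (multinomial_mass a p m)"

lemma size_vectors_0: "size_vectors 0 m = (if m = 0 then {\<lambda>_. 0} else {})"
  by (auto simp: size_vectors_def)

lemma size_vectors_Suc:
  "bij_betw (\<lambda>(j, b). b(Suc a := j)) (SIGMA j:{..m}. size_vectors a (m - j)) (size_vectors (Suc a) m)"
proof -
  have upd: "(\<Sum>s = Suc 0..a. if s = Suc a then j else b s) = sum b {Suc 0..a}"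
    for j :: nat and b :: "nat \<Rightarrow> nat"
    by (intro sum.cong) auto
  show ?thesis
    by (rule bij_betwI[where g = "\<lambda>b. (b (Suc a), b(Suc a := 0))"])
       (auto simp: size_vectors_def fun_eq_iff upd)
qed

lemma finite_size_vectors [simp]: "finite (size_vectors a m)"
proof (induction a arbitrary: m)
  case (Suc a)
  then show ?case
    using bij_betw_finite[OF size_vectors_Suc[of a m]] by auto
qed (auto simp: size_vectors_0)

lemma sum_multinomial_mass:
  "(\<Sum>b\<in>size_vectors a m. multinomial_mass a p m b) = (\<Sum>s=1..a. p s) ^ m"
proof (induction a arbitrary: m)
  case 0
  then show ?case by (auto simp: size_vectors_0 multinomial_mass_def)
next
  case (Suc a)
  have split: "multinomial_mass (Suc a) p m (b(Suc a := j)) =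
      real (m choose j) * p (Suc a) ^ j * multinomial_mass a p (m - j) b"
    if j: "j \<le> m" and b: "b \<in> size_vectors a (m - j)" for j b
  proof -
    have "b(Suc a := j) \<in> size_vectors (Suc a) m"
      using bij_betw_apply[OF size_vectors_Suc[of a m], of "(j, b)"] j b by auto
    moreover have "(\<Prod>s=1..a. fact ((b(Suc a := j)) s) :: real) = (\<Prod>s=1..a. fact (b s))"
      "(\<Prod>s=1..a. p s ^ (b(Suc a := j)) s) = (\<Prod>s=1..a. p s ^ b s)"
      by (auto intro!: prod.cong)
    ultimately show ?thesis
      using j b by (simp add: multinomial_mass_def binomial_fact field_simps)
  qed
  have "(\<Sum>b\<in>size_vectors (Suc a) m. multinomial_mass (Suc a) p m b) =
      (\<Sum>(j, b)\<in>(SIGMA j:{..m}. size_vectors a (m - j)). multinomial_mass (Suc a) p m (b(Suc a := j)))"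
    by (subst sum.reindex_bij_betw[OF size_vectors_Suc, symmetric])
       (simp add: case_prod_unfold)
  also have "\<dots> = (\<Sum>j\<le>m. \<Sum>b\<in>size_vectors a (m - j). multinomial_mass (Suc a) p m (b(Suc a := j)))"
    by (subst sum.Sigma) auto
  also have "\<dots> = (\<Sum>j\<le>m. real (m choose j) * p (Suc a) ^ j * (\<Sum>s=1..a. p s) ^ (m - j))"
    by (simp add: split Suc.IH flip: sum_distrib_left)
  also have "\<dots> = (\<Sum>s=1..Suc a. p s) ^ m"
    by (simp add: binomial_ring add.commute)
  finally show ?case .
qed

lemma pmf_multinomial:
  assumes "\<And>s. s \<in> {1..a} \<Longrightarrow> p s \<ge> 0" "(\<Sum>s=1..a. p s) = 1"
  shows "pmf (multinomial_pmf a p m) b = multinomial_mass a p m b"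
  unfolding multinomial_pmf_def
proof (rule pmf_embed_pmf)
  show nonneg: "0 \<le> multinomial_mass a p m b" for b
    using assms(1) by (auto simp: multinomial_mass_def intro!: mult_nonneg_nonneg divide_nonneg_pos
        prod_nonneg prod_pos)
  have "(\<integral>\<^sup>+ b. ennreal (multinomial_mass a p m b) \<partial>count_space UNIV) =
      (\<integral>\<^sup>+ b. ennreal (multinomial_mass a p m b) \<partial>count_space (size_vectors a m))"
    by (rule nn_integral_count_space_eq) (auto simp: multinomial_mass_def)
  also have "\<dots> = ennreal (\<Sum>b\<in>size_vectors a m. multinomial_mass a p m b)"
    by (simp add: nn_integral_count_space_finite nonneg sum_ennreal)
  finally show "(\<integral>\<^sup>+ b. ennreal (multinomial_mass a p m b) \<partial>count_space UNIV) = 1"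
    using assms(2) by (simp add: sum_multinomial_mass)
qed

definition pile :: "(nat \<Rightarrow> nat) \<Rightarrow> nat \<Rightarrow> nat list" where
  "pile b s = [2 + (\<Sum>r=1..<s. b r) ..< 2 + (\<Sum>r=1..s. b r)]"

text \<open>
  An arrangement \<open>\<gamma>(2), \<dots>, \<gamma>(n)\<close> of the cards \<open>2, \<dots>, n\<close> is a list of length \<open>n - 1\<close>;
  \<open>\<gamma>(j)\<close> is its entry with (0-based) index \<open>j - 2\<close>.
\<close>

definition interleavings :: "nat \<Rightarrow> (nat \<Rightarrow> nat) \<Rightarrow> nat \<Rightarrow> nat list set" where
  "interleavings a b n =
     {\<gamma>. distinct \<gamma> \<and> set \<gamma> = {2..n} \<and>
         (\<forall>s\<in>{1..a}. filter (\<lambda>x. x \<in> set (pile b s)) \<gamma> = pile b s)}"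

lemma finite_interleavings: "finite (interleavings a b n)"
proof (rule finite_subset)
  show "interleavings a b n \<subseteq> {xs. set xs \<subseteq> {2..n} \<and> distinct xs}"
    by (auto simp: interleavings_def)
qed (simp add: finite_subset_distinct)

lemma interleavings_nonempty:
  assumes "b \<in> size_vectors a (n - 1)" "n \<ge> 2"
  shows "[2..<Suc n] \<in> interleavings a b n"
proof -
  have "filter (\<lambda>x. x \<in> set (pile b s)) [2..<Suc n] = pile b s" if s: "s \<in> {1..a}" for s
  proof (rule sorted_distinct_set_unique)
    have "(\<Sum>r=1..s. b r) \<le> (\<Sum>r=1..a. b r)"
      using s by (intro sum_mono2) auto
    also have "\<dots> = n - 1"
      using assms(1) by (simp add: size_vectors_def)
    finally show "set (filter (\<lambda>x. x \<in> set (pile b s)) [2..<Suc n]) = set (pile b s)"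
      using assms(2) by (auto simp: pile_def)
  qed (auto simp: pile_def sorted_wrt_filter simp del: upt_Suc)
  then show ?thesis
    by (auto simp: interleavings_def)
qed

definition riffle_pmf :: "nat \<Rightarrow> (nat \<Rightarrow> real) \<Rightarrow> nat \<Rightarrow> nat list pmf" where
  "riffle_pmf a p n =
     bind_pmf (multinomial_pmf a p (n - 1)) (\<lambda>b. pmf_of_set (interleavings a b n))"

definition parent :: "nat list \<Rightarrow> nat \<Rightarrow> nat" where
  "parent \<gamma> i =
     (let js = filter (\<lambda>j. j < i) (takeWhile (\<lambda>x. x \<noteq> i) \<gamma>)
      in if js = [] then 1 else last js)"

text \<open>
  A tree on the vertices \<open>1, \<dots>, n\<close> with root \<open>1\<close> is represented by its set of (undirected) edges.
\<close>

definition tree_of_arrangement :: "nat \<Rightarrow> nat list \<Rightarrow> nat set set" where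
  "tree_of_arrangement n \<gamma> = {{parent \<gamma> i, i} | i. i \<in> {2..n}}"

definition brt_pmf :: "nat \<Rightarrow> (nat \<Rightarrow> real) \<Rightarrow> nat \<Rightarrow> nat set set pmf" where
  "brt_pmf a p n = map_pmf (tree_of_arrangement n) (riffle_pmf a p n)"

definition vertex_degree :: "'v set set \<Rightarrow> 'v \<Rightarrow> nat" where
  "vertex_degree E v = card {e \<in> E. v \<in> e}"

definition branches :: "nat set set \<Rightarrow> nat" where
  "branches T = vertex_degree T 1"

definition branches_variance :: "nat \<Rightarrow> (nat \<Rightarrow> real) \<Rightarrow> nat \<Rightarrow> real" where
  "branches_variance a p n = measure_pmf.variance (brt_pmf a p n) (\<lambda>T. real (branches T))"

end

theory Submission
  imports Defs "HOL-Combinatorics.Multiset_Permutations"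
begin

text \<open>
  A card is attached to the root exactly if no smaller card precedes it, so the number of branches
  is the number of left-to-right minima of the arrangement (\<open>branches_tree_of_arrangement\<close>).
  Replacing every card by the index of its pile turns an interleaving of piles of sizes \<open>b\<close> into a
  word with letter counts \<open>b\<close>. This is a bijection (\<open>bij_betw_letters\<close>), and it carries left-to-right
  minima to strict left-to-right minima (\<open>record_at_letters\<close>). A uniform word with multinomial letter
  counts is a word of independent letters with law \<open>p\<close> (\<open>multinomial_mixture_of_words\<close>). Hence the
  number of branches is distributed as the number of strict left-to-right minima, called records,
  among \<open>n - 1\<close> independent letters (\<open>branches_distribution\<close>).

  Count positions from \<open>0\<close>. Position \<open>0\<close> is always a record, and position \<open>k\<close> is one with
  probability \<open>\<Sum>s. p s * Q s ^ k\<close>. Two positions \<open>i < k\<close> are both records with probability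
  \<open>\<Sum>s. \<Sum>r<s. p s * p r * Q s ^ i * Q r ^ (k - i - 1)\<close>, where \<open>s\<close> and \<open>r\<close> are the letters at \<open>i\<close>
  and \<open>k\<close>. Expanding the variance of a sum of indicators over the positions \<open>1, \<dots>, n - 2\<close> leaves
  geometric sums in these quantities (\<open>record_sums_closed_form\<close>), with \<open>P s = 1 - Q s\<close> and
  \<open>Q r - Q s = p (r + 1) + \<dots> + p s\<close>. This gives the formula for \<open>n \<ge> 3\<close>; for \<open>n = 2\<close> both sides are
  \<open>0\<close>. Since \<open>0 < Q s < 1\<close> for \<open>1 \<le> s < a\<close>, all powers in the formula tend to \<open>0\<close>, which gives
  the limit.
\<close>

section \<open>Branches as records of the sequence of pile indices\<close>

text \<open>
  Position \<open>k\<close> is a record of \<open>f 0, f 1, \<dots>\<close> if \<open>f k\<close> is strictly smaller than every earlier value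
  (a strict left-to-right minimum). Positions are counted from \<open>0\<close>, and position \<open>0\<close> is always a
  record.
\<close>

definition record_at :: "(nat \<Rightarrow> nat) \<Rightarrow> nat \<Rightarrow> bool" where
  "record_at f k \<longleftrightarrow> (\<forall>j<k. f k < f j)"

lemma parent_eq_1_iff:
  assumes "distinct \<gamma>" "set \<gamma> = {2..n}" "k < length \<gamma>"
  shows "parent \<gamma> (\<gamma> ! k) = 1 \<longleftrightarrow> record_at ((!) \<gamma>) k"
proof -
  have before: "takeWhile (\<lambda>x. x \<noteq> \<gamma> ! k) \<gamma> = take k \<gamma>"
    using assms(1,3) by (intro takeWhile_eq_take_P_nth) (auto simp: nth_eq_iff_index_eq)
  define js where "js = filter (\<lambda>j. j < \<gamma> ! k) (take k \<gamma>)"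
  have "last js \<noteq> 1" if "js \<noteq> []"
  proof -
    have "last js \<in> set \<gamma>"
      using last_in_set[OF that] by (auto simp: js_def dest: in_set_takeD)
    then show ?thesis
      using assms(2) by auto
  qed
  then have "parent \<gamma> (\<gamma> ! k) = 1 \<longleftrightarrow> js = []"
    by (auto simp: parent_def before js_def Let_def)
  also have "\<dots> \<longleftrightarrow> (\<forall>j<k. \<not> \<gamma> ! j < \<gamma> ! k)"
    using assms(3) by (auto simp: js_def filter_empty_conv all_set_conv_all_nth)
  also have "\<dots> \<longleftrightarrow> record_at ((!) \<gamma>) k"
  proof -
    have "\<gamma> ! j \<noteq> \<gamma> ! k" if "j < k" for j
      using assms(1,3) that by (simp add: nth_eq_iff_index_eq)
    then show ?thesis
      by (auto simp: record_at_def not_less order.strict_iff_order)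
  qed
  finally show ?thesis .
qed

text \<open>
  Every card exceeds the root \<open>1\<close>, so the only edges at the root are those from a child to its
  parent \<open>1\<close>, and the degree of the root counts the records of the arrangement.
\<close>

lemma branches_tree_of_arrangement:
  assumes "distinct \<gamma>" "set \<gamma> = {2..n}"
  shows "branches (tree_of_arrangement n \<gamma>) = card {k. k < length \<gamma> \<and> record_at ((!) \<gamma>) k}"
proof -
  let ?R = "{k. k < length \<gamma> \<and> record_at ((!) \<gamma>) k}"
  have "{e \<in> tree_of_arrangement n \<gamma>. 1 \<in> e} = (\<lambda>i. {1, i}) ` {i \<in> {2..n}. parent \<gamma> i = 1}"
  proof (intro subset_antisym subsetI)
    fix e assume "e \<in> {e \<in> tree_of_arrangement n \<gamma>. 1 \<in> e}"
    then obtain i where "e = {parent \<gamma> i, i}" "i \<in> {2..n}" "1 \<in> e"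
      by (auto simp: tree_of_arrangement_def)
    moreover from this have "parent \<gamma> i = 1"
      by auto
    ultimately show "e \<in> (\<lambda>i. {1, i}) ` {i \<in> {2..n}. parent \<gamma> i = 1}"
      by auto
  next
    fix e assume "e \<in> (\<lambda>i. {1, i}) ` {i \<in> {2..n}. parent \<gamma> i = 1}"
    then obtain i where i: "e = {1, i}" "i \<in> {2..n}" "parent \<gamma> i = 1"
      by auto
    then have "e = {parent \<gamma> i, i}"
      by simp
    with i show "e \<in> {e \<in> tree_of_arrangement n \<gamma>. 1 \<in> e}"
      unfolding tree_of_arrangement_def by blast
  qed
  also have "{i \<in> {2..n}. parent \<gamma> i = 1} = {i \<in> set \<gamma>. parent \<gamma> i = 1}"
    by (simp only: assms(2))
  also have "\<dots> = (!) \<gamma> ` {k. k < length \<gamma> \<and> parent \<gamma> (\<gamma> ! k) = 1}"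
    unfolding set_conv_nth by blast
  also have "{k. k < length \<gamma> \<and> parent \<gamma> (\<gamma> ! k) = 1} = ?R"
    using parent_eq_1_iff[OF assms] by blast
  finally have "branches (tree_of_arrangement n \<gamma>) = card ((\<lambda>i. {1, i}) ` ((!) \<gamma> ` ?R))"
    by (simp add: branches_def vertex_degree_def)
  also have "\<dots> = card ((!) \<gamma> ` ?R)"
    by (intro card_image) (auto simp: inj_on_def doubleton_eq_iff)
  also have "\<dots> = card ?R"
    using assms(1) by (intro card_image) (auto simp: inj_on_def nth_eq_iff_index_eq)
  finally show ?thesis .
qed

text \<open>
  The index of the pile that contains card \<open>x\<close>, when the pile sizes are \<open>b\<close>: the first pile whose
  end lies beyond \<open>x\<close>. This is meaningful for cards \<open>x\<close> that belong to some pile.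
\<close>

definition letter :: "(nat \<Rightarrow> nat) \<Rightarrow> nat \<Rightarrow> nat" where
  "letter b x = (LEAST s. x < 2 + (\<Sum>r=1..s. b r))"

lemma letter_in_pile:
  assumes b: "b \<in> size_vectors a (n - 1)" and x: "x \<in> {2..n}"
  shows "letter b x \<in> {1..a}" "x \<in> set (pile b s) \<longleftrightarrow> letter b x = s"
proof -
  define S where "S s = (\<Sum>r=1..s. b r)" for s
  have mono: "S s \<le> S t" if "s \<le> t" for s t
    unfolding S_def using that by (intro sum_mono2) auto
  have "S a = n - 1"
    using b by (simp add: S_def size_vectors_def)
  then have top: "x < 2 + S a"
    using x by auto
  then have least: "x < 2 + S (letter b x)"
    unfolding letter_def S_def by (rule LeastI)
  have le_iff: "letter b x \<le> t \<longleftrightarrow> x < 2 + S t" for t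
    using mono[of "letter b x" t] least Least_le[of "\<lambda>s. x < 2 + S s" t]
    by (fastforce simp: letter_def S_def)
  have pos: "letter b x \<noteq> 0"
    using le_iff[of 0] x by (auto simp: S_def)
  then show "letter b x \<in> {1..a}"
    using le_iff[of a] top by auto
  show "x \<in> set (pile b s) \<longleftrightarrow> letter b x = s"
  proof (cases s)
    case 0
    then show ?thesis using pos by (simp add: pile_def)
  next
    case (Suc t)
    have "x \<in> set (pile b s) \<longleftrightarrow> 2 + S t \<le> x \<and> x < 2 + S s"
      unfolding pile_def set_upt atLeastLessThan_iff S_def Suc
      by (simp only: atLeastLessThanSuc_atLeastAtMost)
    also have "\<dots> \<longleftrightarrow> letter b x = s"
      using le_iff[of t] le_iff[of s] Suc by auto
    finally show ?thesis .
  qed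
qed

lemma set_pile_subset:
  assumes b: "b \<in> size_vectors a (n - 1)"
  shows "set (pile b s) \<subseteq> {2..n}"
proof (cases "s \<in> {1..a}")
  case True
  then have "(\<Sum>r=1..s. b r) \<le> (\<Sum>r=1..a. b r)"
    by (intro sum_mono2) auto
  also have "\<dots> = n - 1"
    using b by (simp add: size_vectors_def)
  finally show ?thesis
    by (auto simp: pile_def)
next
  case False
  then have "b s = 0"
    using b by (auto simp: size_vectors_def)
  then have "pile b s = []"
    by (cases s) (auto simp: pile_def atLeastLessThanSuc_atLeastAtMost)
  then show ?thesis by simp
qed

lemma length_pile:
  assumes "b \<in> size_vectors a m"
  shows "length (pile b s) = b s"
proof (cases s)
  case 0
  then show ?thesis
    using assms by (simp add: pile_def size_vectors_def)
next
  case (Suc t)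
  then show ?thesis
    unfolding pile_def length_upt Suc by (simp add: atLeastLessThanSuc_atLeastAtMost)
qed

lemma letter_mono: 
  assumes b: "b \<in> size_vectors a (n - 1)" and "x \<le> y" "y \<in> {2..n}"
  shows "letter b x \<le> letter b y"
proof -
  have "(\<Sum>r=1..a. b r) = n - 1"
    using b by (simp add: size_vectors_def)
  then have "y < 2 + (\<Sum>r=1..a. b r)"
    using assms(3) by auto
  then have "y < 2 + (\<Sum>r=1..letter b y. b r)"
    unfolding letter_def by (rule LeastI)
  then have "x < 2 + (\<Sum>r=1..letter b y. b r)"
    using assms(2) by simp
  then show ?thesis
    unfolding letter_def[of b x] by (rule Least_le)
qed

lemma filter_letter:
  assumes b: "b \<in> size_vectors a (n - 1)" and \<gamma>: "\<gamma> \<in> interleavings a b n"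
  shows "filter (\<lambda>x. letter b x = s) \<gamma> = pile b s"
proof -
  have "set \<gamma> = {2..n}"
    using \<gamma> by (simp add: interleavings_def)
  then have eq: "filter (\<lambda>x. letter b x = s) \<gamma> = filter (\<lambda>x. x \<in> set (pile b s)) \<gamma>"
    using letter_in_pile(2)[OF b] by (intro filter_cong) auto
  show ?thesis
  proof (cases "s \<in> {1..a}")
    case True
    then show ?thesis
      using \<gamma> by (auto simp: eq interleavings_def)
  next
    case False
    then have "pile b s = []"
      using length_pile[OF b, of s] b by (auto simp: size_vectors_def)
    then show ?thesis
      by (simp add: eq)
  qed
qed

text \<open>
  Replacing each card by the index of its pile does not move the records. Cards of different
  piles are ordered like their piles; cards of the same pile keep their increasing order in the
  arrangement, so a later card of the same pile is not a record, just as a repeated letter is not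
  a strict minimum.
\<close>

lemma record_at_letters:
  assumes b: "b \<in> size_vectors a (n - 1)" and \<gamma>: "\<gamma> \<in> interleavings a b n" and k: "k < length \<gamma>"
  shows "record_at ((!) (map (letter b) \<gamma>)) k \<longleftrightarrow> record_at ((!) \<gamma>) k"
proof -
  have set\<gamma>: "set \<gamma> = {2..n}"
    using \<gamma> by (simp add: interleavings_def)
  have "letter b (\<gamma> ! k) < letter b (\<gamma> ! j) \<longleftrightarrow> \<gamma> ! k < \<gamma> ! j" if j: "j < k" for j
  proof
    have jk: "\<gamma> ! j \<in> {2..n}" "\<gamma> ! k \<in> {2..n}"
      using j k unfolding set\<gamma>[symmetric] by auto
    show "\<gamma> ! k < \<gamma> ! j" if "letter b (\<gamma> ! k) < letter b (\<gamma> ! j)"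
      using that letter_mono[OF b, of "\<gamma> ! j" "\<gamma> ! k"] jk by (auto simp: not_le[symmetric])
    show "letter b (\<gamma> ! k) < letter b (\<gamma> ! j)" if less: "\<gamma> ! k < \<gamma> ! j"
    proof (rule ccontr)
      assume "\<not> ?thesis"
      then have eq: "letter b (\<gamma> ! k) = letter b (\<gamma> ! j)"
        using letter_mono[OF b, of "\<gamma> ! k" "\<gamma> ! j"] less jk by auto
      \<comment> \<open>Both cards lie in pile \<open>s\<close>, whose cards occur in increasing order, and \<open>\<gamma> ! j\<close> comes first.\<close>
      define s where "s = letter b (\<gamma> ! j)"
      have split: "\<gamma> = take j \<gamma> @ \<gamma> ! j # drop (Suc j) \<gamma>"
        using j k by (simp add: id_take_nth_drop)
      have "\<gamma> ! k = drop (Suc j) \<gamma> ! (k - Suc j)" "k - Suc j < length (drop (Suc j) \<gamma>)"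
        using j k by auto
      then have "\<gamma> ! k \<in> set (drop (Suc j) \<gamma>)"
        by (metis nth_mem)
      moreover have "sorted (filter (\<lambda>x. letter b x = s) \<gamma>)"
        unfolding filter_letter[OF b \<gamma>] pile_def by (rule sorted_upt)
      then have "\<forall>x\<in>set (drop (Suc j) \<gamma>). letter b x = s \<longrightarrow> \<gamma> ! j \<le> x"
        by (subst (asm) split) (auto simp: sorted_append s_def)
      ultimately show False
        using less eq by (auto simp: s_def)
    qed
  qed
  then show ?thesis
    using k by (auto simp: record_at_def)
qed

text \<open>
  A list is determined by its sequence of labels together with, for each label, the sublist
  of the entries carrying it; and every compatible choice of these data is realised.
\<close>

lemma eq_by_labels:
  assumes "map l xs = map l ys" "\<And>s. filter (\<lambda>x. l x = s) xs = filter (\<lambda>x. l x = s) ys"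
  shows "xs = ys"
proof -
  from assms(1) have "length xs = length ys" by (rule map_eq_imp_length_eq)
  then show ?thesis using assms
  proof (induction xs ys rule: list_induct2)
    case (Cons x xs y ys)
    have "x = y" 
      using Cons.prems(1) Cons.prems(2)[of "l x"] by auto
    moreover have "filter (\<lambda>x. l x = s) xs = filter (\<lambda>x. l x = s) ys" for s
      using Cons.prems(1) Cons.prems(2)[of s] \<open>x = y\<close> by (auto split: if_splits)
    ultimately show ?case using Cons by auto
  qed simp
qed

lemma distinct_by_labels:
  assumes "\<And>s. distinct (filter (\<lambda>x. l x = s) xs)"
  shows "distinct xs"
  using assms
proof (induction xs)
  case (Cons x xs)
  have "distinct (filter (\<lambda>y. l y = s) xs)" for s
    using Cons.prems[of s] by (auto split: if_splits)
  moreover have "x \<notin> set xs"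
    using Cons.prems[of "l x"] by auto
  ultimately show ?case
    using Cons.IH by simp
qed simp

lemma ex_shuffle_with_labels:
  assumes "\<And>s. length (ps s) = count_list w s" "\<And>s x. x \<in> set (ps s) \<Longrightarrow> l x = s"
  shows "\<exists>xs. map l xs = w \<and> (\<forall>s. filter (\<lambda>x. l x = s) xs = ps s)"
  using assms
proof (induction w arbitrary: ps)
  case Nil
  then show ?case by auto
next
  case (Cons c w)
  obtain x rest where c: "ps c = x # rest"
    using Cons.prems(1)[of c] by (cases "ps c") auto
  obtain xs where xs: "map l xs = w" "\<And>s. filter (\<lambda>x. l x = s) xs = (ps(c := rest)) s"
  proof -
    have "\<exists>xs. map l xs = w \<and> (\<forall>s. filter (\<lambda>x. l x = s) xs = (ps(c := rest)) s)"
    proof (rule Cons.IH)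
      show "length ((ps(c := rest)) s) = count_list w s" for s
        using Cons.prems(1)[of s] c by (auto split: if_splits)
      show "l x = s" if "x \<in> set ((ps(c := rest)) s)" for s x
        using Cons.prems(2)[of x s] that c by (auto split: if_splits)
    qed
    then show ?thesis using that by blast
  qed
  have "l x = c"
    using Cons.prems(2)[of x c] c by auto
  then have "map l (x # xs) = c # w \<and> (\<forall>s. filter (\<lambda>x. l x = s) (x # xs) = ps s)"
    using xs c by auto
  then show ?case by (rule exI)
qed

text \<open>The words in which each letter \<open>s\<close> occurs exactly \<open>b s\<close> times.\<close>

definition words_with_counts :: "(nat \<Rightarrow> nat) \<Rightarrow> nat list set" where
  "words_with_counts b = {w. \<forall>s. count_list w s = b s}"

text \<open>
  The interleavings of piles of sizes \<open>b\<close> correspond to the words with letter counts \<open>b\<close>: reading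
  off pile indices gives the word, and the interleaving is recovered by filling the occurrences of
  each letter with the cards of that pile in increasing order.
\<close>

lemma bij_betw_letters:
  assumes b: "b \<in> size_vectors a (n - 1)"
  shows "bij_betw (map (letter b)) (interleavings a b n) (words_with_counts b)"
  unfolding bij_betw_def
proof (intro conjI subset_antisym subsetI)
  show "inj_on (map (letter b)) (interleavings a b n)"
  proof (rule inj_onI)
    fix \<gamma> \<delta> assume "\<gamma> \<in> interleavings a b n" "\<delta> \<in> interleavings a b n"
      and "map (letter b) \<gamma> = map (letter b) \<delta>"
    then show "\<gamma> = \<delta>"
      using filter_letter[OF b] by (metis eq_by_labels)
  qed
next
  fix w assume "w \<in> map (letter b) ` interleavings a b n"
  then obtain \<gamma> where \<gamma>: "\<gamma> \<in> interleavings a b n" "w = map (letter b) \<gamma>"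
    by auto
  have "count_list w s = length (filter (\<lambda>x. letter b x = s) \<gamma>)" for s
    unfolding \<gamma>(2) by (induction \<gamma>) simp_all
  then show "w \<in> words_with_counts b"
    by (simp add: words_with_counts_def filter_letter[OF b \<gamma>(1)] length_pile[OF b])
next
  fix w assume w: "w \<in> words_with_counts b"
  have letter_pile: "letter b x = s" if "x \<in> set (pile b s)" for s x
    using letter_in_pile(2)[OF b, of x s] set_pile_subset[OF b, of s] that by auto
  have "\<exists>\<gamma>. map (letter b) \<gamma> = w \<and> (\<forall>s. filter (\<lambda>x. letter b x = s) \<gamma> = pile b s)"
    using w letter_pile
    by (intro ex_shuffle_with_labels) (auto simp: words_with_counts_def length_pile[OF b])
  then obtain \<gamma> where \<gamma>: "map (letter b) \<gamma> = w" "\<And>s. filter (\<lambda>x. letter b x = s) \<gamma> = pile b s"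
    by auto
  have in_set: "x \<in> set \<gamma> \<longleftrightarrow> x \<in> set (pile b (letter b x))" for x
    unfolding \<gamma>(2)[of "letter b x", symmetric] by simp
  have set\<gamma>: "set \<gamma> = {2..n}"
  proof (intro subset_antisym subsetI)
    show "x \<in> {2..n}" if "x \<in> set \<gamma>" for x
      using that in_set[of x] set_pile_subset[OF b, of "letter b x"] by blast
    show "x \<in> set \<gamma>" if "x \<in> {2..n}" for x
      using in_set[of x] letter_in_pile(2)[OF b that] by auto
  qed
  have "distinct \<gamma>"
    by (rule distinct_by_labels[of "letter b"]) (simp only: \<gamma>(2) pile_def distinct_upt)
  moreover have "filter (\<lambda>x. x \<in> set (pile b s)) \<gamma> = filter (\<lambda>x. letter b x = s) \<gamma>" for s
    using letter_in_pile(2)[OF b] unfolding set\<gamma>[symmetric] by (intro filter_cong) auto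
  ultimately have "\<gamma> \<in> interleavings a b n"
    using set\<gamma> \<gamma>(2) by (simp add: interleavings_def)
  then show "w \<in> map (letter b) ` interleavings a b n"
    using \<gamma>(1) by auto
qed

section \<open>The word of pile indices has independent letters\<close>

lemma words_with_counts_eq_permutations:
  assumes "b \<in> size_vectors a m"
  shows "words_with_counts b = permutations_of_multiset (\<Sum>s\<in>{1..a}. replicate_mset (b s) s)"
proof -
  have "count (\<Sum>s\<in>{1..a}. replicate_mset (b s) s) x = b x" for x
    using assms by (auto simp: count_sum size_vectors_def)
  then show ?thesis
    by (auto simp: words_with_counts_def permutations_of_multiset_def multiset_eq_iff
        simp flip: count_mset)
qed

lemma finite_words_with_counts:
  assumes "b \<in> size_vectors a m"
  shows "finite (words_with_counts b)" "words_with_counts b \<noteq> {}"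
  by (simp_all add: words_with_counts_eq_permutations[OF assms] permutations_of_multiset_not_empty)

lemma card_words_with_counts:
  assumes b: "b \<in> size_vectors a m"
  shows "card (words_with_counts b) * (\<Prod>s=1..a. fact (b s)) = fact m"
proof -
  let ?M = "\<Sum>s\<in>{1..a}. replicate_mset (b s) s"
  have count: "count ?M x = b x" for x
    using b by (auto simp: count_sum size_vectors_def)
  have "(\<Prod>s\<in>set_mset ?M. fact (count ?M s) :: nat) = (\<Prod>s=1..a. fact (b s))"
    unfolding count
  proof (rule prod.mono_neutral_left)
    show "set_mset ?M \<subseteq> {1..a}"
      by (auto simp: set_mset_sum split: if_splits)
    show "\<forall>s\<in>{1..a} - set_mset ?M. fact (b s) = (1 :: nat)"
    proof
      fix s assume "s \<in> {1..a} - set_mset ?M"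
      then have "count ?M s = 0"
        by (simp only: Diff_iff not_in_iff)
      then show "fact (b s) = (1 :: nat)"
        by (simp only: count fact_0)
    qed
  qed simp
  moreover have "size ?M = m"
    using b by (simp add: size_multiset_sum size_vectors_def)
  ultimately show ?thesis
    using card_permutations_of_multiset_aux[of ?M]
    by (simp add: words_with_counts_eq_permutations[OF b])
qed

lemma prod_list_map_eq_prod_count:
  fixes f :: "'a \<Rightarrow> 'b::comm_monoid_mult"
  assumes "set w \<subseteq> A" "finite A"
  shows "prod_list (map f w) = (\<Prod>x\<in>A. f x ^ count_list w x)"
  using assms(1)
proof (induction w)
  case (Cons c w)
  have "(\<Prod>x\<in>A. f x ^ count_list (c # w) x) = (\<Prod>x\<in>A. (if c = x then f x else 1) * f x ^ count_list w x)"
    by (intro prod.cong) auto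
  also have "\<dots> = f c * (\<Prod>x\<in>A. f x ^ count_list w x)"
    using Cons.prems assms(2) by (simp add: prod.distrib)
  finally show ?case
    using Cons by simp
qed simp

text \<open>Independent letters with law \<open>L\<close>, read as a word of length \<open>m\<close>.\<close>

lemma pmf_iid_word:
  fixes L :: "nat pmf"
  shows "pmf (map_pmf (\<lambda>f. map f [0..<m]) (Pi_pmf {..<m} 0 (\<lambda>_. L))) w =
    (if length w = m then prod_list (map (pmf L) w) else 0)"
proof (cases "length w = m")
  case True
  let ?M = "Pi_pmf {..<m} 0 (\<lambda>_. L)"
  let ?f = "\<lambda>k. if k < m then w ! k else 0"
  have "pmf (map_pmf (\<lambda>f. map f [0..<m]) ?M) w = measure ?M ((\<lambda>f. map f [0..<m]) -` {w})"
    by (rule pmf_map)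
  also have "\<dots> = measure ?M {?f}"
  proof (rule measure_pmf.finite_measure_eq_AE)
    have "f \<in> (\<lambda>f. map f [0..<m]) -` {w} \<longleftrightarrow> f \<in> {?f}" if "f \<in> set_pmf ?M" for f
    proof -
      have "f k = 0" if "\<not> k < m" for k
        using set_Pi_pmf_subset[of "{..<m}" 0 "\<lambda>_. L"] \<open>f \<in> set_pmf ?M\<close> that by auto
      then show ?thesis
        using True by (auto simp: list_eq_iff_nth_eq fun_eq_iff)
    qed
    then show "AE f in ?M. f \<in> (\<lambda>f. map f [0..<m]) -` {w} \<longleftrightarrow> f \<in> {?f}"
      by (simp add: AE_measure_pmf_iff)
  qed auto
  also have "\<dots> = (\<Prod>k<m. pmf L (w ! k))"
    unfolding measure_pmf_single by (subst pmf_Pi') auto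
  also have "\<dots> = prod_list (map (pmf L) w)"
    using True by (simp add: prod.list_conv_set_nth atLeast0LessThan)
  finally show ?thesis
    using True by simp
next
  case False
  then have "(\<lambda>f. map f [0..<m]) -` {w} = {}"
    by auto
  then show ?thesis
    using False by (simp only: pmf_map measure_empty if_False)
qed

lemma count_list_in_size_vectors_iff:
  "count_list w \<in> size_vectors a m \<longleftrightarrow> set w \<subseteq> {1..a} \<and> length w = m"
proof -
  have "(\<forall>s. s \<notin> {1..a} \<longrightarrow> count_list w s = 0) \<longleftrightarrow> set w \<subseteq> {1..a}"
    by (auto simp: count_list_0_iff)
  moreover have "(\<Sum>s=1..a. count_list w s) = length w" if "set w \<subseteq> {1..a}"
    using sum_count_set[OF that] by simp
  ultimately show ?thesis
    by (auto simp: size_vectors_def)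
qed

text \<open>
  A word of independent letters can be drawn by first drawing its letter counts, which are
  multinomial, and then a uniform word with these counts: the multinomial coefficient in the
  probability of the counts is exactly the number of words with these counts.
\<close>

lemma multinomial_mixture_of_words:
  fixes L :: "nat pmf"
  assumes L: "\<And>s. pmf L s = (if s \<in> {1..a} then p s else 0)" and p_sum: "(\<Sum>s=1..a. p s) = 1"
  shows "bind_pmf (multinomial_pmf a p m) (\<lambda>b. pmf_of_set (words_with_counts b)) =
    map_pmf (\<lambda>f. map f [0..<m]) (Pi_pmf {..<m} 0 (\<lambda>_. L))"
proof (rule pmf_eqI)
  fix w :: "nat list"
  have p_nonneg: "p s \<ge> 0" if "s \<in> {1..a}" for s
    using L[of s] that pmf_nonneg[of L s] by simp
  have pmf_mult: "pmf (multinomial_pmf a p m) b = multinomial_mass a p m b" for b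
    using p_nonneg p_sum by (rule pmf_multinomial)
  let ?c = "count_list w"
  let ?N = "real (card (words_with_counts ?c))"
  have "pmf (bind_pmf (multinomial_pmf a p m) (\<lambda>b. pmf_of_set (words_with_counts b))) w =
      (\<integral>b. pmf (pmf_of_set (words_with_counts b)) w \<partial>multinomial_pmf a p m)"
    by (rule pmf_bind)
  also have "\<dots> = (\<integral>b. indicator {?c} b / ?N \<partial>multinomial_pmf a p m)"
  proof (rule integral_cong_AE)
    \<comment> \<open>The only letter counts compatible with \<open>w\<close> are those of \<open>w\<close> itself.\<close>
    have "pmf (pmf_of_set (words_with_counts b)) w = indicator {?c} b / ?N"
      if "b \<in> set_pmf (multinomial_pmf a p m)" for b
    proof -
      have "b \<in> size_vectors a m"
        using that by (auto simp: set_pmf_eq pmf_mult multinomial_mass_def split: if_splits)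
      note fin = finite_words_with_counts[OF this]
      have "w \<in> words_with_counts b \<longleftrightarrow> b = ?c"
        by (auto simp: words_with_counts_def fun_eq_iff)
      then show ?thesis
        using fin by (auto simp: indicator_def)
    qed
    then show "AE b in multinomial_pmf a p m.
        pmf (pmf_of_set (words_with_counts b)) w = indicator {?c} b / ?N"
      by (simp add: AE_measure_pmf_iff)
  qed auto
  also have "\<dots> = multinomial_mass a p m ?c / ?N"
    by (simp add: measure_pmf_single pmf_mult)
  also have "\<dots> = (if length w = m then prod_list (map (pmf L) w) else 0)"
  proof (cases "?c \<in> size_vectors a m")
    case True
    then have w: "set w \<subseteq> {1..a}" "length w = m"
      by (auto simp: count_list_in_size_vectors_iff)
    have "?N * (\<Prod>s=1..a. fact (?c s)) = fact m"
      using arg_cong[OF card_words_with_counts[OF True], of real] by simp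
    moreover have "prod_list (map (pmf L) w) = (\<Prod>s=1..a. p s ^ ?c s)"
      using w by (subst prod_list_map_eq_prod_count[of _ "{1..a}"]) (auto simp: L)
    moreover have "(\<Prod>s=1..a. fact (?c s) :: real) \<noteq> 0"
      by simp
    moreover have "?N \<noteq> 0"
      using finite_words_with_counts[OF True] by simp
    ultimately show ?thesis
      using True w by (simp add: multinomial_mass_def divide_simps) (simp add: ac_simps)
  next
    case False
    have "prod_list (map (pmf L) w) = 0" if len: "length w = m"
    proof -
      obtain x where "x \<in> set w" "x \<notin> {1..a}"
        using False len unfolding count_list_in_size_vectors_iff by blast
      then show ?thesis
        by (auto simp: prod_list_zero_iff L intro!: image_eqI[of _ _ x])
    qed
    then show ?thesis
      using False by (simp add: multinomial_mass_def)
  qed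
  finally show "pmf (bind_pmf (multinomial_pmf a p m) (\<lambda>b. pmf_of_set (words_with_counts b))) w =
      pmf (map_pmf (\<lambda>f. map f [0..<m]) (Pi_pmf {..<m} 0 (\<lambda>_. L))) w"
    by (simp only: pmf_iid_word)
qed

lemma branches_distribution:
  fixes L :: "nat pmf"
  assumes L: "\<And>s. pmf L s = (if s \<in> {1..a} then p s else 0)" and p_sum: "(\<Sum>s=1..a. p s) = 1"
    and n: "n \<ge> 2"
  shows "map_pmf branches (brt_pmf a p n) =
    map_pmf (\<lambda>f. card {k. k < n - 1 \<and> record_at f k}) (Pi_pmf {..<n-1} 0 (\<lambda>_. L))"
proof -
  have p_nonneg: "p s \<ge> 0" if "s \<in> {1..a}" for s
    using L[of s] that pmf_nonneg[of L s] by simp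
  let ?R = "\<lambda>w :: nat list. card {k. k < length w \<and> record_at ((!) w) k}"
  let ?mult = "multinomial_pmf a p (n - 1)"
  have inner: "map_pmf (\<lambda>\<gamma>. branches (tree_of_arrangement n \<gamma>)) (pmf_of_set (interleavings a b n)) =
      map_pmf ?R (pmf_of_set (words_with_counts b))" if "b \<in> set_pmf ?mult" for b
  proof -
    have "pmf ?mult b = multinomial_mass a p (n - 1) b"
      using p_nonneg p_sum by (rule pmf_multinomial)
    then have b: "b \<in> size_vectors a (n - 1)"
      using that by (auto simp: set_pmf_eq multinomial_mass_def split: if_splits)
    have ne: "interleavings a b n \<noteq> {}"
      using interleavings_nonempty[OF b n] by auto
    note fin = finite_interleavings[of a b n]
    have "branches (tree_of_arrangement n \<gamma>) = ?R (map (letter b) \<gamma>)"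
      if \<gamma>: "\<gamma> \<in> interleavings a b n" for \<gamma>
    proof -
      have "branches (tree_of_arrangement n \<gamma>) = ?R \<gamma>"
        using \<gamma> by (intro branches_tree_of_arrangement) (auto simp: interleavings_def)
      also have "{k. k < length \<gamma> \<and> record_at ((!) \<gamma>) k} =
          {k. k < length (map (letter b) \<gamma>) \<and> record_at ((!) (map (letter b) \<gamma>)) k}"
        using record_at_letters[OF b \<gamma>] by auto
      finally show ?thesis .
    qed
    then have "map_pmf (\<lambda>\<gamma>. branches (tree_of_arrangement n \<gamma>)) (pmf_of_set (interleavings a b n)) =
        map_pmf (\<lambda>\<gamma>. ?R (map (letter b) \<gamma>)) (pmf_of_set (interleavings a b n))"
      using ne fin by (intro map_pmf_cong) auto
    also have "\<dots> = map_pmf ?R (map_pmf (map (letter b)) (pmf_of_set (interleavings a b n)))"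
      by (simp add: pmf.map_comp o_def)
    also have "map_pmf (map (letter b)) (pmf_of_set (interleavings a b n)) =
        pmf_of_set (words_with_counts b)"
      by (rule map_pmf_of_set_bij_betw[OF bij_betw_letters[OF b] ne fin])
    finally show ?thesis .
  qed
  have "map_pmf branches (brt_pmf a p n) = bind_pmf ?mult
      (\<lambda>b. map_pmf (\<lambda>\<gamma>. branches (tree_of_arrangement n \<gamma>)) (pmf_of_set (interleavings a b n)))"
    by (simp add: brt_pmf_def riffle_pmf_def map_bind_pmf pmf.map_comp o_def)
  also have "\<dots> = bind_pmf ?mult (\<lambda>b. map_pmf ?R (pmf_of_set (words_with_counts b)))"
    by (intro bind_pmf_cong refl inner)
  also have "\<dots> = map_pmf ?R (bind_pmf ?mult (\<lambda>b. pmf_of_set (words_with_counts b)))"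
    by (simp only: map_bind_pmf)
  also have "\<dots> = map_pmf (\<lambda>f. ?R (map f [0..<n-1])) (Pi_pmf {..<n-1} 0 (\<lambda>_. L))"
    unfolding multinomial_mixture_of_words[OF L p_sum] by (simp add: pmf.map_comp o_def)
  also have "(\<lambda>f. ?R (map f [0..<n-1])) = (\<lambda>f. card {k. k < n - 1 \<and> record_at f k})"
    by (intro ext arg_cong[where f = card]) (auto simp: record_at_def)
  finally show ?thesis .
qed

section \<open>Probabilities of records and the variance of their number\<close>

text \<open>
  Position \<open>k\<close> is a record with value \<open>s\<close> precisely if the letter there is \<open>s\<close> and the \<open>k\<close> letters
  before it are all larger than \<open>s\<close>.
\<close>

lemma prob_record_at:
  fixes L :: "nat pmf"
  assumes S: "finite S" "set_pmf L \<subseteq> S" and k: "k < m"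
  shows "measure_pmf.prob (Pi_pmf {..<m} d (\<lambda>_. L)) {f. record_at f k} =
    (\<Sum>s\<in>S. pmf L s * measure_pmf.prob L {s<..} ^ k)"
proof -
  let ?M = "Pi_pmf {..<m} d (\<lambda>_. L)"
  \<comment> \<open>\<open>B s j\<close> is the set of values permitted at position \<open>j\<close> if \<open>k\<close> is a record with value \<open>s\<close>.\<close>
  define B where "B s j = (if j < k then {s<..} else if j = k then {s} else UNIV)" for s j :: nat
  have prod: "(\<Prod>j<m. measure_pmf.prob L (B s j)) = pmf L s * measure_pmf.prob L {s<..} ^ k" for s
  proof -
    have "(\<Prod>j<m. measure_pmf.prob L (B s j)) = (\<Prod>j\<in>{..<Suc k}. measure_pmf.prob L (B s j))"
      using k by (intro prod.mono_neutral_right) (auto simp: B_def)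
    also have "(\<Prod>j<k. measure_pmf.prob L (B s j)) = (\<Prod>j<k. measure_pmf.prob L {s<..})"
      by (intro prod.cong) (auto simp: B_def)
    then have "(\<Prod>j\<in>{..<Suc k}. measure_pmf.prob L (B s j)) = pmf L s * measure_pmf.prob L {s<..} ^ k"
      by (simp add: B_def measure_pmf_single)
    finally show ?thesis .
  qed
  have "measure_pmf.prob ?M {f. record_at f k} =
      measure_pmf.prob ?M (\<Union>s\<in>S. PiE_dflt {..<m} d (B s))"
  proof (rule measure_pmf.finite_measure_eq_AE)
    have "f \<in> {f. record_at f k} \<longleftrightarrow> f \<in> (\<Union>s\<in>S. PiE_dflt {..<m} d (B s))"
      if "f \<in> set_pmf ?M" for f
    proof -
      have "f \<in> PiE_dflt {..<m} d (\<lambda>_. set_pmf L)"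
        using set_Pi_pmf_subset'[of "{..<m}" d "\<lambda>_. L"] that by auto
      then have f: "\<And>j. j < m \<Longrightarrow> f j \<in> S" "\<And>j. \<not> j < m \<Longrightarrow> f j = d"
        using S(2) by (auto simp: PiE_dflt_def)
      have "f \<in> PiE_dflt {..<m} d (B s) \<longleftrightarrow> f k = s \<and> record_at f k" for s
        using f(2) k by (auto simp: PiE_dflt_def B_def record_at_def split: if_splits)
      then show ?thesis
        using f(1)[OF k] by auto
    qed
    then show "AE f in ?M. f \<in> {f. record_at f k} \<longleftrightarrow> f \<in> (\<Union>s\<in>S. PiE_dflt {..<m} d (B s))"
      by (simp add: AE_measure_pmf_iff)
  qed auto
  also have "\<dots> = (\<Sum>s\<in>S. measure_pmf.prob ?M (PiE_dflt {..<m} d (B s)))"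
  proof (rule measure_pmf.finite_measure_finite_Union)
    show "disjoint_family_on (\<lambda>s. PiE_dflt {..<m} d (B s)) S"
      using k by (force simp: disjoint_family_on_def PiE_dflt_def B_def)
  qed (use S in auto)
  also have "\<dots> = (\<Sum>s\<in>S. pmf L s * measure_pmf.prob L {s<..} ^ k)"
    by (simp add: measure_Pi_pmf_PiE_dflt prod)
  finally show ?thesis .
qed

text \<open>
  Positions \<open>i < k\<close> are records with values \<open>s\<close> and \<open>r\<close> precisely if \<open>r < s\<close>, the letters at these
  positions are \<open>s\<close> and \<open>r\<close>, the letters before \<open>i\<close> exceed \<open>s\<close>, and those strictly between exceed \<open>r\<close>.
\<close>

lemma prob_record_at_both:
  fixes L :: "nat pmf"
  assumes S: "finite S" "set_pmf L \<subseteq> S" and ik: "i < k" "k < m"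
  shows "measure_pmf.prob (Pi_pmf {..<m} d (\<lambda>_. L)) {f. record_at f i \<and> record_at f k} =
    (\<Sum>s\<in>S. \<Sum>r\<in>S \<inter> {..<s}. pmf L s * pmf L r * measure_pmf.prob L {s<..} ^ i *
       measure_pmf.prob L {r<..} ^ (k - i - 1))"
proof -
  let ?M = "Pi_pmf {..<m} d (\<lambda>_. L)"
  \<comment> \<open>\<open>B (s, r) j\<close> is the set of values permitted at position \<open>j\<close>, for record values \<open>s\<close> and \<open>r\<close>.\<close>
  define B where "B = (\<lambda>(s, r) j. if j < i then {s<..} else if j = i then {s} else
    if j < k then {r<..} else if j = k then {r} else (UNIV :: nat set))"
  let ?I = "SIGMA s:S. S \<inter> {..<s}"
  have prod: "(\<Prod>j<m. measure_pmf.prob L (B (s, r) j)) = pmf L s * pmf L r *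
      measure_pmf.prob L {s<..} ^ i * measure_pmf.prob L {r<..} ^ (k - i - 1)" for s r
  proof -
    let ?g = "\<lambda>j. measure_pmf.prob L (B (s, r) j)"
    have "prod ?g {..<m} = prod ?g {..<Suc k}"
      using ik by (intro prod.mono_neutral_right) (auto simp: B_def)
    also have "\<dots> = prod ?g {..<k} * pmf L r"
      using ik by (simp add: B_def measure_pmf_single)
    also have "{..<k} = {..<i} \<union> {i} \<union> {i<..<k}"
      using ik by auto
    also have "prod ?g ({..<i} \<union> {i} \<union> {i<..<k}) = prod ?g {..<i} * ?g i * prod ?g {i<..<k}"
      by (subst prod.union_disjoint; (subst prod.union_disjoint)?) auto
    also have "prod ?g {..<i} = measure_pmf.prob L {s<..} ^ i"
      by (simp add: B_def)
    also have "?g i = pmf L s"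
      by (simp add: B_def measure_pmf_single)
    also have "prod ?g {i<..<k} = (\<Prod>j\<in>{i<..<k}. measure_pmf.prob L {r<..})"
      by (intro prod.cong) (auto simp: B_def)
    also have "\<dots> = measure_pmf.prob L {r<..} ^ (k - i - 1)"
      by simp
    finally show ?thesis
      by (simp add: ac_simps)
  qed
  have "measure_pmf.prob ?M {f. record_at f i \<and> record_at f k} =
      measure_pmf.prob ?M (\<Union>x\<in>?I. PiE_dflt {..<m} d (B x))"
  proof (rule measure_pmf.finite_measure_eq_AE)
    have "f \<in> {f. record_at f i \<and> record_at f k} \<longleftrightarrow> f \<in> (\<Union>x\<in>?I. PiE_dflt {..<m} d (B x))"
      if "f \<in> set_pmf ?M" for f
    proof -
      have "f \<in> PiE_dflt {..<m} d (\<lambda>_. set_pmf L)"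
        using set_Pi_pmf_subset'[of "{..<m}" d "\<lambda>_. L"] that by auto
      then have f: "\<And>j. j < m \<Longrightarrow> f j \<in> S" "\<And>j. \<not> j < m \<Longrightarrow> f j = d"
        using S(2) by (auto simp: PiE_dflt_def)
      have PiE: "f \<in> PiE_dflt {..<m} d (B (s, r)) \<longleftrightarrow> f i = s \<and> f k = r \<and> record_at f i \<and> record_at f k"
        if "r < s" for s r
      proof
        assume "f \<in> PiE_dflt {..<m} d (B (s, r))"
        then have fB: "f j \<in> B (s, r) j" if "j < m" for j
          using that by (auto simp: PiE_dflt_def)
        have eq: "f i = s" "f k = r"
          using fB[of i] fB[of k] ik by (auto simp: B_def)
        have before: "f i < f j" if "j < i" for j
          using fB[of j] ik that eq by (auto simp: B_def)
        have "f k < f j" if "j < k" for j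
          using fB[of j] ik that eq \<open>r < s\<close> before[of j] by (cases j i rule: linorder_cases) (auto simp: B_def)
        then show "f i = s \<and> f k = r \<and> record_at f i \<and> record_at f k"
          using eq before by (auto simp: record_at_def)
      next
        assume "f i = s \<and> f k = r \<and> record_at f i \<and> record_at f k"
        then show "f \<in> PiE_dflt {..<m} d (B (s, r))"
          using f(2) ik by (auto simp: PiE_dflt_def B_def record_at_def)
      qed
      have "f k < f i" if "record_at f k"
        using that ik by (auto simp: record_at_def)
      then have "f \<in> {f. record_at f i \<and> record_at f k} \<longleftrightarrow>
          (\<exists>(s, r)\<in>?I. f i = s \<and> f k = r \<and> record_at f i \<and> record_at f k)"
        using f(1)[of i] f(1)[of k] ik by auto
      also have "\<dots> \<longleftrightarrow> (\<exists>x\<in>?I. f \<in> PiE_dflt {..<m} d (B x))"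
        using PiE by auto
      finally show ?thesis
        by auto
    qed
    then show "AE f in ?M. f \<in> {f. record_at f i \<and> record_at f k} \<longleftrightarrow>
        f \<in> (\<Union>x\<in>?I. PiE_dflt {..<m} d (B x))"
      by (simp add: AE_measure_pmf_iff)
  qed auto
  also have "\<dots> = (\<Sum>x\<in>?I. measure_pmf.prob ?M (PiE_dflt {..<m} d (B x)))"
  proof (rule measure_pmf.finite_measure_finite_Union)
    show "disjoint_family_on (\<lambda>x. PiE_dflt {..<m} d (B x)) ?I"
    proof (unfold disjoint_family_on_def, intro ballI impI equals0I)
      fix x y f assume "x \<noteq> y" and f: "f \<in> PiE_dflt {..<m} d (B x) \<inter> PiE_dflt {..<m} d (B y)"
      have "f j \<in> B x j \<inter> B y j" if "j < m" for j
        using f that by (auto simp: PiE_dflt_def)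
      from this[of i] this[of k] have "x = y"
        using ik by (cases x; cases y) (auto simp: B_def)
      with \<open>x \<noteq> y\<close> show False ..
    qed
  qed (use S in auto)
  also have "\<dots> = (\<Sum>(s, r)\<in>?I. \<Prod>j<m. measure_pmf.prob L (B (s, r) j))"
    by (simp add: measure_Pi_pmf_PiE_dflt case_prod_unfold)
  also have "\<dots> = (\<Sum>s\<in>S. \<Sum>r\<in>S \<inter> {..<s}. \<Prod>j<m. measure_pmf.prob L (B (s, r) j))"
    using S(1) by (subst sum.Sigma) auto
  finally show ?thesis
    by (simp only: prod)
qed

lemma power2_sum_ivl:
  fixes x :: "nat \<Rightarrow> 'a::comm_ring_1"
  shows "(\<Sum>k=1..<m. x k)\<^sup>2 = (\<Sum>k=1..<m. (x k)\<^sup>2) + 2 * (\<Sum>k=1..<m. \<Sum>i=1..<k. x i * x k)"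
proof (induction m)
  case (Suc m)
  show ?case
  proof (cases "m = 0")
    case False
    then show ?thesis
      using Suc by (simp add: power2_eq_square algebra_simps sum_distrib_left)
  qed simp
qed simp

lemma variance_card_records:
  fixes M :: "(nat \<Rightarrow> nat) pmf"
  assumes fin: "finite (set_pmf M)" and m: "m \<ge> 1"
  defines "e \<equiv> \<lambda>k. measure_pmf.prob M {f. record_at f k}"
  shows "measure_pmf.variance M (\<lambda>f. real (card {k. k < m \<and> record_at f k})) =
    (\<Sum>k=1..<m. e k) - (\<Sum>k=1..<m. (e k)\<^sup>2)
    + 2 * (\<Sum>k=1..<m. \<Sum>i=1..<k. measure_pmf.prob M {f. record_at f i \<and> record_at f k})
    - 2 * (\<Sum>k=1..<m. \<Sum>i=1..<k. e i * e k)"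
proof -
  have [simp]: "integrable M X" for X :: "(nat \<Rightarrow> nat) \<Rightarrow> real"
    using fin by (rule integrable_measure_pmf_finite)
  let ?E = "measure_pmf.expectation M"
  define Z where "Z k f = (indicator {f. record_at f k} f :: real)" for k f
  \<comment> \<open>Position \<open>0\<close> is a record with certainty, so it does not contribute to the variance.\<close>
  have card: "real (card {k. k < m \<and> record_at f k}) = (\<Sum>k=1..<m. Z k f) + 1" for f
  proof -
    have "{k. k < m \<and> record_at f k} = insert 0 {k \<in> {1..<m}. record_at f k}"
      using m by (auto simp: record_at_def)
    moreover have "card (insert 0 {k \<in> {1..<m}. record_at f k}) = Suc (card {k \<in> {1..<m}. record_at f k})"
      by (rule card_insert_disjoint) auto
    ultimately have "real (card {k. k < m \<and> record_at f k}) = real (card {k \<in> {1..<m}. record_at f k}) + 1"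
      by simp
    also have "real (card {k \<in> {1..<m}. record_at f k}) = (\<Sum>k=1..<m. Z k f)"
      by (simp add: Z_def indicator_def sum.If_cases Int_def)
    finally show ?thesis .
  qed
  have EZ: "?E (Z k) = e k" for k
    by (simp add: Z_def[abs_def] e_def)
  have Z_sq: "(Z k f)\<^sup>2 = Z k f" for k f
    by (simp add: Z_def indicator_def)
  have EZZ: "?E (\<lambda>f. Z i f * Z k f) = measure_pmf.prob M {f. record_at f i \<and> record_at f k}" for i k
  proof -
    have "(\<lambda>f. Z i f * Z k f) = indicator {f. record_at f i \<and> record_at f k}"
      by (auto simp: Z_def indicator_def)
    then show ?thesis by simp
  qed
  have "measure_pmf.variance M (\<lambda>f. real (card {k. k < m \<and> record_at f k})) =
      measure_pmf.variance M (\<lambda>f. \<Sum>k=1..<m. Z k f)"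
    by (simp add: card measure_pmf.prob_space)
  also have "\<dots> = ?E (\<lambda>f. (\<Sum>k=1..<m. Z k f)\<^sup>2) - (?E (\<lambda>f. \<Sum>k=1..<m. Z k f))\<^sup>2"
    by (rule measure_pmf.variance_eq) simp_all
  also have "(\<lambda>f. (\<Sum>k=1..<m. Z k f)\<^sup>2) =
      (\<lambda>f. (\<Sum>k=1..<m. Z k f) + 2 * (\<Sum>k=1..<m. \<Sum>i=1..<k. Z i f * Z k f))"
    by (simp only: power2_sum_ivl Z_sq)
  also have "?E \<dots> =
      (\<Sum>k=1..<m. e k) + 2 * (\<Sum>k=1..<m. \<Sum>i=1..<k. measure_pmf.prob M {f. record_at f i \<and> record_at f k})"
    by (simp add: EZ EZZ)
  also have "?E (\<lambda>f. \<Sum>k=1..<m. Z k f) = (\<Sum>k=1..<m. e k)"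
    by (simp add: EZ)
  finally show ?thesis
    by (simp only: power2_sum_ivl)
qed

text \<open>
  The variance in terms of the record probabilities. The letter \<open>a\<close> drops out of all sums: it has
  no larger letter, so \<open>Q a = 0\<close> and it can only be a record at position \<open>0\<close>.
\<close>

lemma branches_variance_records:
  fixes p Q :: "nat \<Rightarrow> real"
  assumes p_pos: "\<And>s. s \<in> {1..a} \<Longrightarrow> p s > 0" and p_sum: "(\<Sum>s=1..a. p s) = 1"
    and Q_def: "\<And>s. Q s = (\<Sum>l=s+1..a. p l)" and n: "n \<ge> 2"
  defines "e \<equiv> \<lambda>k. \<Sum>s=1..<a. p s * Q s ^ k"
  shows "branches_variance a p n =
    (\<Sum>k=1..<n-1. e k) - (\<Sum>k=1..<n-1. (e k)\<^sup>2)
    + 2 * (\<Sum>k=1..<n-1. \<Sum>i=1..<k. \<Sum>s=1..<a. \<Sum>r=1..<s. p s * p r * Q s ^ i * Q r ^ (k - i - 1))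
    - 2 * (\<Sum>k=1..<n-1. \<Sum>i=1..<k. e i * e k)"
proof -
  define L where "L = embed_pmf (\<lambda>s. if s \<in> {1..a} then p s else 0)"
  have L: "pmf L s = (if s \<in> {1..a} then p s else 0)" for s
    unfolding L_def
  proof (rule pmf_embed_pmf)
    show nonneg: "0 \<le> (if s \<in> {1..a} then p s else 0)" for s
      using p_pos[of s] by auto
    have "(\<integral>\<^sup>+ s. ennreal (if s \<in> {1..a} then p s else 0) \<partial>count_space UNIV) =
        (\<integral>\<^sup>+ s. ennreal (p s) \<partial>count_space {1..a})"
      by (subst nn_integral_count_space_indicator)
         (auto intro!: nn_integral_cong simp: indicator_def)
    also have "\<dots> = ennreal (\<Sum>s=1..a. p s)"
      by (subst sum_ennreal[symmetric]) (use p_pos in \<open>auto simp: nn_integral_count_space_finite less_imp_le\<close>)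
    finally show "(\<integral>\<^sup>+ s. ennreal (if s \<in> {1..a} then p s else 0) \<partial>count_space UNIV) = 1"
      using p_sum by simp
  qed
  have set_L: "set_pmf L \<subseteq> {1..a}"
    by (auto simp: set_pmf_eq L split: if_splits)
  have prob_L: "measure_pmf.prob L {s<..} = Q s" for s
  proof -
    have "measure_pmf.prob L {s<..} = measure_pmf.prob L {s+1..a}"
      using set_L by (intro measure_pmf.finite_measure_eq_AE) (auto simp: AE_measure_pmf_iff)
    also have "\<dots> = (\<Sum>l=s+1..a. pmf L l)"
      by (simp add: measure_measure_pmf_finite)
    also have "\<dots> = Q s"
      unfolding Q_def by (intro sum.cong) (auto simp: L)
    finally show ?thesis .
  qed
  have Q_a: "Q a = 0"
    by (simp add: Q_def)
  have drop_last: "(\<Sum>s=1..a. g s) = (\<Sum>s=1..<a. g s)" if "g a = 0" for g :: "nat \<Rightarrow> real"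
  proof (rule sum.mono_neutral_right)
    show "\<forall>s\<in>{1..a} - {1..<a}. g s = 0"
    proof
      fix s assume "s \<in> {1..a} - {1..<a}"
      then have "s = a" by auto
      then show "g s = 0" using that by simp
    qed
  qed auto
  let ?M = "Pi_pmf {..<n-1} 0 (\<lambda>_. L)"
  have fin: "finite (set_pmf ?M)"
    using finite_subset[OF set_L] by (subst set_Pi_pmf) auto
  have e: "measure_pmf.prob ?M {f. record_at f k} = e k" if "k \<in> {1..<n-1}" for k
  proof -
    have "measure_pmf.prob ?M {f. record_at f k} = (\<Sum>s=1..a. p s * Q s ^ k)"
      using that by (subst prob_record_at[OF _ set_L]) (auto simp: prob_L L intro!: sum.cong)
    also have "\<dots> = e k"
      unfolding e_def using that by (intro drop_last) (simp add: Q_a)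
    finally show ?thesis .
  qed
  have e2: "measure_pmf.prob ?M {f. record_at f i \<and> record_at f k} =
      (\<Sum>s=1..<a. \<Sum>r=1..<s. p s * p r * Q s ^ i * Q r ^ (k - i - 1))"
    if "i \<in> {1..<k}" "k \<in> {1..<n-1}" for i k
  proof -
    have "measure_pmf.prob ?M {f. record_at f i \<and> record_at f k} =
        (\<Sum>s=1..a. \<Sum>r\<in>{1..a} \<inter> {..<s}. pmf L s * pmf L r * Q s ^ i * Q r ^ (k - i - 1))"
      using that by (subst prob_record_at_both[OF _ set_L]) (auto simp: prob_L)
    also have "\<dots> = (\<Sum>s=1..a. \<Sum>r=1..<s. p s * p r * Q s ^ i * Q r ^ (k - i - 1))"
      by (intro sum.cong) (auto simp: L)
    also have "\<dots> = (\<Sum>s=1..<a. \<Sum>r=1..<s. p s * p r * Q s ^ i * Q r ^ (k - i - 1))"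
      using that by (intro drop_last) (auto simp: Q_a power_0_left)
    finally show ?thesis .
  qed
  have "branches_variance a p n = measure_pmf.variance (map_pmf branches (brt_pmf a p n)) real"
    by (simp add: branches_variance_def)
  also have "\<dots> = measure_pmf.variance ?M (\<lambda>f. real (card {k. k < n - 1 \<and> record_at f k}))"
    unfolding branches_distribution[OF L p_sum n] by simp
  also have "\<dots> = (\<Sum>k=1..<n-1. e k) - (\<Sum>k=1..<n-1. (e k)\<^sup>2)
    + 2 * (\<Sum>k=1..<n-1. \<Sum>i=1..<k. \<Sum>s=1..<a. \<Sum>r=1..<s. p s * p r * Q s ^ i * Q r ^ (k - i - 1))
    - 2 * (\<Sum>k=1..<n-1. \<Sum>i=1..<k. e i * e k)"
  proof -
    have "1 \<le> n - 1"
      using n by simp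
    note variance_card_records[OF fin this]
    also have "(\<Sum>k=1..<n-1. measure_pmf.prob ?M {f. record_at f k}) = (\<Sum>k=1..<n-1. e k)"
      by (intro sum.cong refl e)
    also have "(\<Sum>k=1..<n-1. (measure_pmf.prob ?M {f. record_at f k})\<^sup>2) = (\<Sum>k=1..<n-1. (e k)\<^sup>2)"
      by (intro sum.cong refl) (simp only: e)
    also have "(\<Sum>k=1..<n-1. \<Sum>i=1..<k. measure_pmf.prob ?M {f. record_at f i \<and> record_at f k}) =
        (\<Sum>k=1..<n-1. \<Sum>i=1..<k. \<Sum>s=1..<a. \<Sum>r=1..<s. p s * p r * Q s ^ i * Q r ^ (k - i - 1))"
      by (intro sum.cong refl e2)
    also have "(\<Sum>k=1..<n-1. \<Sum>i=1..<k. measure_pmf.prob ?M {f. record_at f i} *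
        measure_pmf.prob ?M {f. record_at f k}) = (\<Sum>k=1..<n-1. \<Sum>i=1..<k. e i * e k)"
      by (intro sum.cong refl arg_cong2[where f = "(*)"] e) auto
    finally show ?thesis .
  qed
  finally show ?thesis .
qed

section \<open>Summation of the record probabilities\<close>

lemma sum_power_ivl:
  fixes x :: real
  assumes "x \<noteq> 1"
  shows "(\<Sum>k=1..<M+1. x ^ k) = x * (1 - x ^ M) / (1 - x)"
proof (induction M)
  case (Suc M)
  have "(\<Sum>k=1..<Suc M + 1. x ^ k) = x * (1 - x ^ M) / (1 - x) + x ^ (M + 1)"
    using Suc by simp
  also have "\<dots> = x * (1 - x ^ Suc M) / (1 - x)"
    using assms by (simp add: divide_simps) (simp add: algebra_simps)
  finally show ?case .
qed simp

lemma sum_power_mixed: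
  fixes x y :: real
  assumes "x \<noteq> y"
  shows "(\<Sum>i=1..<M+1. x ^ i * y ^ (M - i)) = x * (y ^ M - x ^ M) / (y - x)"
proof (induction M)
  case (Suc M)
  have "(\<Sum>i=1..<Suc M + 1. x ^ i * y ^ (Suc M - i)) =
      (\<Sum>i=1..<M + 1. x ^ i * y ^ (Suc M - i)) + x ^ Suc M"
    by simp
  also have "(\<Sum>i=1..<M + 1. x ^ i * y ^ (Suc M - i)) = y * (\<Sum>i=1..<M + 1. x ^ i * y ^ (M - i))"
    unfolding sum_distrib_left by (intro sum.cong) (auto simp: Suc_diff_le)
  also have "\<dots> + x ^ Suc M = x * (y ^ Suc M - x ^ Suc M) / (y - x)"
    unfolding Suc using assms by (simp add: divide_simps) (simp add: algebra_simps)
  finally show ?case .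
qed simp

text \<open>
  The expressions on the right of the next two identities are grouped to match the terms of
  the variance formula; both are telescoping sums, proved by induction on \<open>N\<close>.
\<close>

lemma double_sum_gaps:
  fixes x y :: real
  assumes "x \<noteq> y" "x \<noteq> 1" "y \<noteq> 1"
  shows "(\<Sum>k=1..<N+2. \<Sum>i=1..<k. x ^ i * y ^ (k - i - 1)) =
    x / (1 - x) * (1 / (1 - y)) * (1 - x ^ N) - x * (y / (1 - y)) * (1 / (y - x)) * (y ^ N - x ^ N)"
proof (induction N)
  case (Suc N)
  have "(\<Sum>k=1..<Suc N+2. \<Sum>i=1..<k. x ^ i * y ^ (k - i - 1)) =
      (\<Sum>k=1..<N+2. \<Sum>i=1..<k. x ^ i * y ^ (k - i - 1)) +
      (\<Sum>i=1..<(N + 1) + 1. x ^ i * y ^ ((N + 1) - i))"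
    by simp
  also have "\<dots> = x / (1 - x) * (1 / (1 - y)) * (1 - x ^ N)
      - x * (y / (1 - y)) * (1 / (y - x)) * (y ^ N - x ^ N)
      + x * (y ^ (N + 1) - x ^ (N + 1)) / (y - x)"
    unfolding Suc sum_power_mixed[OF assms(1)] ..
  also have "\<dots> = x / (1 - x) * (1 / (1 - y)) * (1 - x ^ Suc N)
      - x * (y / (1 - y)) * (1 / (y - x)) * (y ^ Suc N - x ^ Suc N)"
    using assms by (simp add: divide_simps) (simp add: algebra_simps)
  finally show ?case .
qed simp

lemma double_sum_products:
  fixes x y :: real
  assumes "x * y \<noteq> 1" "x \<noteq> 1" "y \<noteq> 1"
  shows "(\<Sum>k=1..<N+2. \<Sum>i=1..<k. x ^ i * y ^ k) =
    x * (1 / (1 - y) * y\<^sup>2 * ((1 - (x * y) ^ N) / (1 - x * y)))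
    - 1 / (1 - x) * x * (1 / (1 - y) * y ^ (N + 2) * (1 - x ^ N))"
proof (induction N)
  case (Suc N)
  have "(\<Sum>k=1..<Suc N+2. \<Sum>i=1..<k. x ^ i * y ^ k) =
      (\<Sum>k=1..<N+2. \<Sum>i=1..<k. x ^ i * y ^ k) + (\<Sum>i=1..<(N + 1) + 1. x ^ i) * y ^ (N + 2)"
    unfolding sum_distrib_right by simp
  also have "\<dots> = x * (1 / (1 - y) * y\<^sup>2 * ((1 - (x * y) ^ N) / (1 - x * y)))
      - 1 / (1 - x) * x * (1 / (1 - y) * y ^ (N + 2) * (1 - x ^ N))
      + x * (1 - x ^ (N + 1)) / (1 - x) * y ^ (N + 2)"
    unfolding Suc sum_power_ivl[OF assms(2)] ..
  also have "\<dots> = x * (1 / (1 - y) * y\<^sup>2 * ((1 - (x * y) ^ Suc N) / (1 - x * y)))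
      - 1 / (1 - x) * x * (1 / (1 - y) * y ^ (Suc N + 2) * (1 - x ^ Suc N))"
    using assms by (simp add: divide_simps power2_eq_square power_mult_distrib) (simp add: algebra_simps)
  finally show ?case .
qed simp

text \<open>
  Summing the four parts of the variance over the positions \<open>1, \<dots>, N + 1\<close>: exchange the sums over
  positions with those over letters, then evaluate geometric sums letter by letter. Here \<open>e k\<close> is
  the probability that position \<open>k\<close> is a record.
\<close>

lemma record_sums_closed_form:
  fixes p P Q :: "nat \<Rightarrow> real"
  assumes Q: "\<And>s. s \<in> {1..<a} \<Longrightarrow> 0 < Q s" "\<And>s. s \<in> {1..<a} \<Longrightarrow> Q s < 1"
    and P: "\<And>s. s \<in> {1..<a} \<Longrightarrow> P s = 1 - Q s"
    and less: "\<And>r s. s \<in> {1..<a} \<Longrightarrow> r \<in> {1..<s} \<Longrightarrow> Q s < Q r"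
    and diff: "\<And>r s. s \<in> {1..<a} \<Longrightarrow> r \<in> {1..<s} \<Longrightarrow> (\<Sum>q=r+1..s. p q) = Q r - Q s"
  defines "e \<equiv> \<lambda>k. \<Sum>s=1..<a. p s * Q s ^ k"
  shows "(\<Sum>k=1..<N+2. e k) = (\<Sum>s=1..<a. p s / P s * (1 - Q s ^ (N + 2))) - (\<Sum>s=1..<a. p s)"
    and "(\<Sum>k=1..<N+2. (e k)\<^sup>2) =
      (\<Sum>s=1..<a. p s ^ 2 * Q s ^ 2 * ((1 - Q s ^ (2 * (N + 1))) / (1 - Q s ^ 2))) +
      2 * (\<Sum>s=1..<a. \<Sum>r=1..<s. p s * p r * Q s * Q r * ((1 - (Q s * Q r) ^ (N + 1)) / (1 - Q s * Q r)))"
    and "(\<Sum>k=1..<N+2. \<Sum>i=1..<k. \<Sum>s=1..<a. \<Sum>r=1..<s. p s * p r * Q s ^ i * Q r ^ (k - i - 1)) =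
      (\<Sum>s=1..<a. p s * Q s / P s * (\<Sum>r=1..<s. p r / P r * (1 - Q s ^ N))) -
      (\<Sum>s=1..<a. p s * Q s *
        (\<Sum>r=1..<s. p r * Q r / P r * (1 / (\<Sum>q=r+1..s. p q)) * (Q r ^ N - Q s ^ N)))"
    and "(\<Sum>k=1..<N+2. \<Sum>i=1..<k. e i * e k) =
      (\<Sum>s=1..<a. p s * Q s *
        (\<Sum>r=1..<a. p r / P r * Q r ^ 2 * ((1 - (Q s * Q r) ^ N) / (1 - Q s * Q r)))) -
      (\<Sum>s=1..<a. p s / P s * Q s *
        (\<Sum>r=1..<a. p r / P r * Q r ^ (N + 2) * (1 - Q s ^ N)))"
proof -
  have QQ: "Q s * Q r < 1" if "s \<in> {1..<a}" "r \<in> {1..<a}" for r s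
    using mult_strict_mono[of "Q s" 1 "Q r" 1] Q that by (simp add: less_imp_le)
  have "(\<Sum>k=1..<N+2. e k) = (\<Sum>s=1..<a. p s * (\<Sum>k=1..<(N+1)+1. Q s ^ k))"
    unfolding e_def sum_distrib_left by (subst sum.swap) simp
  also have "\<dots> = (\<Sum>s=1..<a. p s / P s * (1 - Q s ^ (N + 2)) - p s)"
  proof (intro sum.cong refl)
    fix s assume s: "s \<in> {1..<a}"
    then have ne: "Q s \<noteq> 1"
      using Q(2)[of s] by simp
    show "p s * (\<Sum>k=1..<(N+1)+1. Q s ^ k) = p s / P s * (1 - Q s ^ (N + 2)) - p s"
      unfolding sum_power_ivl[OF ne] P[OF s] using ne
      by (simp add: divide_simps) (simp add: algebra_simps)
  qed
  finally show "(\<Sum>k=1..<N+2. e k) =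
      (\<Sum>s=1..<a. p s / P s * (1 - Q s ^ (N + 2))) - (\<Sum>s=1..<a. p s)"
    by (simp only: sum_subtractf)

  have "(\<Sum>k=1..<N+2. (e k)\<^sup>2) = (\<Sum>k=1..<N+2. \<Sum>s=1..<a. (p s * Q s ^ k)\<^sup>2) +
      2 * (\<Sum>k=1..<N+2. \<Sum>s=1..<a. \<Sum>r=1..<s. (p r * Q r ^ k) * (p s * Q s ^ k))"
    unfolding e_def power2_sum_ivl sum.distrib sum_distrib_left ..
  also have "(\<Sum>k=1..<N+2. \<Sum>s=1..<a. (p s * Q s ^ k)\<^sup>2) =
      (\<Sum>s=1..<a. p s ^ 2 * (\<Sum>k=1..<(N+1)+1. (Q s ^ 2) ^ k))"
    unfolding sum_distrib_left
    by (subst sum.swap) (simp add: power_mult_distrib mult.commute flip: power_mult)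
  also have "\<dots> = (\<Sum>s=1..<a. p s ^ 2 * Q s ^ 2 * ((1 - Q s ^ (2 * (N + 1))) / (1 - Q s ^ 2)))"
  proof (intro sum.cong refl)
    fix s assume "s \<in> {1..<a}"
    then have ne: "Q s ^ 2 \<noteq> 1"
      using QQ[of s s] by (simp add: power2_eq_square)
    show "p s ^ 2 * (\<Sum>k=1..<(N+1)+1. (Q s ^ 2) ^ k) =
        p s ^ 2 * Q s ^ 2 * ((1 - Q s ^ (2 * (N + 1))) / (1 - Q s ^ 2))"
      unfolding sum_power_ivl[OF ne] by (simp only: power_mult mult.assoc times_divide_eq_right)
  qed
  also have "(\<Sum>k=1..<N+2. \<Sum>s=1..<a. \<Sum>r=1..<s. (p r * Q r ^ k) * (p s * Q s ^ k)) =
      (\<Sum>s=1..<a. \<Sum>k=1..<N+2. \<Sum>r=1..<s. (p r * Q r ^ k) * (p s * Q s ^ k))"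
    by (rule sum.swap)
  also have "\<dots> = (\<Sum>s=1..<a. \<Sum>r=1..<s. \<Sum>k=1..<N+2. (p r * Q r ^ k) * (p s * Q s ^ k))"
    by (intro sum.cong refl sum.swap)
  also have "\<dots> = (\<Sum>s=1..<a. \<Sum>r=1..<s.
      p s * p r * Q s * Q r * ((1 - (Q s * Q r) ^ (N + 1)) / (1 - Q s * Q r)))"
  proof (intro sum.cong refl)
    fix s r assume "s \<in> {1..<a}" "r \<in> {1..<s}"
    then have "Q s * Q r \<noteq> 1"
      using QQ[of s r] by simp
    have "(\<Sum>k=1..<N+2. (p r * Q r ^ k) * (p s * Q s ^ k)) =
        p s * p r * (\<Sum>k=1..<(N+1)+1. (Q s * Q r) ^ k)"
      unfolding sum_distrib_left by (intro sum.cong) (simp_all add: power_mult_distrib ac_simps)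
    also have "\<dots> = p s * p r * Q s * Q r * ((1 - (Q s * Q r) ^ (N + 1)) / (1 - Q s * Q r))"
      unfolding sum_power_ivl[OF \<open>Q s * Q r \<noteq> 1\<close>] by (simp only: mult.assoc times_divide_eq_right)
    finally show "(\<Sum>k=1..<N+2. (p r * Q r ^ k) * (p s * Q s ^ k)) =
        p s * p r * Q s * Q r * ((1 - (Q s * Q r) ^ (N + 1)) / (1 - Q s * Q r))" .
  qed
  finally show "(\<Sum>k=1..<N+2. (e k)\<^sup>2) =
      (\<Sum>s=1..<a. p s ^ 2 * Q s ^ 2 * ((1 - Q s ^ (2 * (N + 1))) / (1 - Q s ^ 2))) +
      2 * (\<Sum>s=1..<a. \<Sum>r=1..<s. p s * p r * Q s * Q r * ((1 - (Q s * Q r) ^ (N + 1)) / (1 - Q s * Q r)))" .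

  have "(\<Sum>k=1..<N+2. \<Sum>i=1..<k. \<Sum>s=1..<a. \<Sum>r=1..<s. p s * p r * Q s ^ i * Q r ^ (k - i - 1)) =
      (\<Sum>k=1..<N+2. \<Sum>s=1..<a. \<Sum>i=1..<k. \<Sum>r=1..<s. p s * p r * Q s ^ i * Q r ^ (k - i - 1))"
    by (intro sum.cong refl sum.swap)
  also have "\<dots> = (\<Sum>s=1..<a. \<Sum>k=1..<N+2. \<Sum>i=1..<k. \<Sum>r=1..<s. p s * p r * Q s ^ i * Q r ^ (k - i - 1))"
    by (rule sum.swap)
  also have "\<dots> = (\<Sum>s=1..<a. \<Sum>k=1..<N+2. \<Sum>r=1..<s. \<Sum>i=1..<k. p s * p r * Q s ^ i * Q r ^ (k - i - 1))"
    by (intro sum.cong refl sum.swap)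
  also have "\<dots> = (\<Sum>s=1..<a. \<Sum>r=1..<s. \<Sum>k=1..<N+2. \<Sum>i=1..<k. p s * p r * Q s ^ i * Q r ^ (k - i - 1))"
    by (intro sum.cong refl sum.swap)
  also have "\<dots> = (\<Sum>s=1..<a. \<Sum>r=1..<s.
      p s * Q s / P s * (p r / P r * (1 - Q s ^ N)) -
      p s * Q s * (p r * Q r / P r * (1 / (\<Sum>q=r+1..s. p q)) * (Q r ^ N - Q s ^ N)))"
  proof (intro sum.cong refl)
    fix s r assume "s \<in> {1..<a}" "r \<in> {1..<s}"
    then have ne: "Q s \<noteq> Q r" "Q s \<noteq> 1" "Q r \<noteq> 1"
      and PD: "P s = 1 - Q s" "P r = 1 - Q r" "(\<Sum>q=r+1..s. p q) = Q r - Q s"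
      using less[of s r] Q(2)[of s] Q(2)[of r] P[of s] P[of r] diff[of s r] by auto
    have "(\<Sum>k=1..<N+2. \<Sum>i=1..<k. p s * p r * Q s ^ i * Q r ^ (k - i - 1)) =
        p s * p r * (\<Sum>k=1..<N+2. \<Sum>i=1..<k. Q s ^ i * Q r ^ (k - i - 1))"
      by (simp only: sum_distrib_left mult.assoc)
    also have "\<dots> = p s * Q s / P s * (p r / P r * (1 - Q s ^ N)) -
      p s * Q s * (p r * Q r / P r * (1 / (\<Sum>q=r+1..s. p q)) * (Q r ^ N - Q s ^ N))"
      unfolding double_sum_gaps[OF ne] PD by (simp add: right_diff_distrib ac_simps)
    finally show "(\<Sum>k=1..<N+2. \<Sum>i=1..<k. p s * p r * Q s ^ i * Q r ^ (k - i - 1)) = \<dots>" .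
  qed
  finally show "(\<Sum>k=1..<N+2. \<Sum>i=1..<k. \<Sum>s=1..<a. \<Sum>r=1..<s. p s * p r * Q s ^ i * Q r ^ (k - i - 1)) =
      (\<Sum>s=1..<a. p s * Q s / P s * (\<Sum>r=1..<s. p r / P r * (1 - Q s ^ N))) -
      (\<Sum>s=1..<a. p s * Q s *
        (\<Sum>r=1..<s. p r * Q r / P r * (1 / (\<Sum>q=r+1..s. p q)) * (Q r ^ N - Q s ^ N)))"
    by (simp only: sum_subtractf sum_distrib_left)

  have "(\<Sum>k=1..<N+2. \<Sum>i=1..<k. e i * e k) =
      (\<Sum>k=1..<N+2. \<Sum>i=1..<k. \<Sum>s=1..<a. \<Sum>r=1..<a. p s * Q s ^ i * (p r * Q r ^ k))"
    by (simp only: e_def sum_product)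
  also have "\<dots> =
      (\<Sum>k=1..<N+2. \<Sum>s=1..<a. \<Sum>i=1..<k. \<Sum>r=1..<a. p s * Q s ^ i * (p r * Q r ^ k))"
    by (intro sum.cong refl sum.swap)
  also have "\<dots> = (\<Sum>s=1..<a. \<Sum>k=1..<N+2. \<Sum>i=1..<k. \<Sum>r=1..<a. p s * Q s ^ i * (p r * Q r ^ k))"
    by (rule sum.swap)
  also have "\<dots> = (\<Sum>s=1..<a. \<Sum>k=1..<N+2. \<Sum>r=1..<a. \<Sum>i=1..<k. p s * Q s ^ i * (p r * Q r ^ k))"
    by (intro sum.cong refl sum.swap)
  also have "\<dots> = (\<Sum>s=1..<a. \<Sum>r=1..<a. \<Sum>k=1..<N+2. \<Sum>i=1..<k. p s * Q s ^ i * (p r * Q r ^ k))"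
    by (intro sum.cong refl sum.swap)
  also have "\<dots> = (\<Sum>s=1..<a. \<Sum>r=1..<a.
      p s * Q s * (p r / P r * Q r ^ 2 * ((1 - (Q s * Q r) ^ N) / (1 - Q s * Q r))) -
      p s / P s * Q s * (p r / P r * Q r ^ (N + 2) * (1 - Q s ^ N)))"
  proof (intro sum.cong refl)
    fix s r assume "s \<in> {1..<a}" "r \<in> {1..<a}"
    then have ne: "Q s * Q r \<noteq> 1" "Q s \<noteq> 1" "Q r \<noteq> 1"
      and PD: "P s = 1 - Q s" "P r = 1 - Q r"
      using QQ[of s r] Q(2)[of s] Q(2)[of r] P[of s] P[of r] by auto
    have "(\<Sum>k=1..<N+2. \<Sum>i=1..<k. p s * Q s ^ i * (p r * Q r ^ k)) =
        p s * p r * (\<Sum>k=1..<N+2. \<Sum>i=1..<k. Q s ^ i * Q r ^ k)"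
      by (simp only: sum_distrib_left mult.assoc mult.left_commute)
    also have "\<dots> = p s * Q s * (p r / P r * Q r ^ 2 * ((1 - (Q s * Q r) ^ N) / (1 - Q s * Q r))) -
      p s / P s * Q s * (p r / P r * Q r ^ (N + 2) * (1 - Q s ^ N))"
      unfolding double_sum_products[OF ne] PD by (simp add: right_diff_distrib ac_simps)
    finally show "(\<Sum>k=1..<N+2. \<Sum>i=1..<k. p s * Q s ^ i * (p r * Q r ^ k)) = \<dots>" .
  qed
  finally show "(\<Sum>k=1..<N+2. \<Sum>i=1..<k. e i * e k) =
      (\<Sum>s=1..<a. p s * Q s *
        (\<Sum>r=1..<a. p r / P r * Q r ^ 2 * ((1 - (Q s * Q r) ^ N) / (1 - Q s * Q r)))) -
      (\<Sum>s=1..<a. p s / P s * Q s *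
        (\<Sum>r=1..<a. p r / P r * Q r ^ (N + 2) * (1 - Q s ^ N)))"
    by (simp only: sum_subtractf sum_distrib_left)
qed

text \<open>For \<open>s = 1\<close> the inner sums are empty, so the outer sums may as well start at \<open>1\<close>.\<close>

lemma sum_ivl_drop_first:
  fixes c :: "nat \<Rightarrow> real"
  shows "(\<Sum>s=2..a-1. c s * (\<Sum>r=1..s-1. f s r)) = (\<Sum>s=1..<a. c s * (\<Sum>r=1..<s. f s r))" (is ?A)
    and "(\<Sum>s=2..a-1. \<Sum>r=1..s-1. f s r) = (\<Sum>s=1..<a. \<Sum>r=1..<s. f s r)" (is ?B)
proof -
  have outer: "(\<Sum>s=2..a-1. g s) = (\<Sum>s=1..<a. g s)" if "g 1 = 0" for g :: "nat \<Rightarrow> real"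
  proof (rule sum.mono_neutral_left)
    show "\<forall>s\<in>{1..<a} - {2..a-1}. g s = 0"
    proof
      fix s assume "s \<in> {1..<a} - {2..a-1}"
      then have "s = 1"
        by auto
      then show "g s = 0"
        using that by simp
    qed
  qed auto
  have inner: "{1..s-1} = {1..<s}" for s :: nat
    by auto
  show ?A ?B
    unfolding inner by (rule outer, simp)+
qed

section \<open>The variance and its limit\<close>

theorem theorem3p2:
  fixes a :: nat and p P Q :: "nat \<Rightarrow> real"
  assumes "a \<ge> 1"
    and p_pos: "\<And>s. s \<in> {1..a} \<Longrightarrow> p s > 0"
    and p_sum: "(\<Sum>s=1..a. p s) = 1"
    and P_def: "\<And>s. P s = (\<Sum>l=1..s. p l)"
    and Q_def: "\<And>s. Q s = (\<Sum>l=s+1..a. p l)"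
  shows "(\<forall>n\<ge>2. branches_variance a p n =
        (\<Sum>s=1..a-1. p s / P s * (1 - Q s ^ (n-1)))
      - (\<Sum>s=1..a-1. p s)
      - (\<Sum>s=1..a-1. p s ^ 2 * Q s ^ 2 * ((1 - Q s ^ (2*(n-2))) / (1 - Q s ^ 2)))
      - 2 * (\<Sum>s=2..a-1. \<Sum>r=1..s-1.
               p s * p r * Q s * Q r * ((1 - (Q s * Q r) ^ (n-2)) / (1 - Q s * Q r)))
      + 2 * (\<Sum>s=2..a-1. p s * Q s / P s *
               (\<Sum>r=1..s-1. p r / P r * (1 - Q s powi (int n - 3))))
      - 2 * (\<Sum>s=2..a-1. p s * Q s *
               (\<Sum>r=1..s-1. p r * Q r / P r * (1 / (\<Sum>q=r+1..s. p q)) *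
                  (Q r powi (int n - 3) - Q s powi (int n - 3))))
      - 2 * (\<Sum>s=1..a-1. p s * Q s *
               (\<Sum>r=1..a-1. p r / P r * Q r ^ 2 *
                  ((1 - (Q s * Q r) powi (int n - 3)) / (1 - Q s * Q r))))
      + 2 * (\<Sum>s=1..a-1. p s / P s * Q s *
               (\<Sum>r=1..a-1. p r / P r * Q r ^ (n-1) * (1 - Q s powi (int n - 3)))))
    \<and> (\<lambda>n. branches_variance a p n) \<longlonglongrightarrow>
        (\<Sum>s=1..a-1. p s / P s)
      - (\<Sum>s=1..a-1. p s)
      - (\<Sum>s=1..a-1. p s ^ 2 * Q s ^ 2 * (1 / (1 - Q s ^ 2)))
      - 2 * (\<Sum>s=2..a-1. \<Sum>r=1..s-1. p s * p r * Q s * Q r * (1 / (1 - Q s * Q r)))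
      + 2 * (\<Sum>s=2..a-1. p s * Q s / P s * (\<Sum>r=1..s-1. p r / P r))
      - 2 * (\<Sum>s=1..a-1. p s * Q s *
               (\<Sum>r=1..a-1. p r / P r * Q r ^ 2 * (1 / (1 - Q s * Q r))))"
proof -
  have Q_pos: "0 < Q s" if "s \<in> {1..<a}" for s
    unfolding Q_def using that p_pos by (intro sum_pos) auto
  have P_pos: "0 < P s" if "s \<in> {1..<a}" for s
    unfolding P_def using that p_pos by (intro sum_pos) auto
  have P_eq: "P s = 1 - Q s" if "s \<in> {1..<a}" for s
  proof -
    have "{1..a} = {1..s} \<union> {s+1..a}"
      using that by auto
    then have "(\<Sum>l=1..a. p l) = P s + Q s"
      unfolding P_def Q_def by (simp only:) (rule sum.union_disjoint, auto)
    then show ?thesis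
      using p_sum by simp
  qed
  have Q_less_1: "Q s < 1" if "s \<in> {1..<a}" for s
    using P_pos[OF that] P_eq[OF that] by simp
  have diff: "(\<Sum>q=r+1..s. p q) = Q r - Q s" if "s \<in> {1..<a}" "r \<in> {1..<s}" for r s
  proof -
    have "{r+1..a} = {r+1..s} \<union> {s+1..a}"
      using that by auto
    then have "Q r = (\<Sum>q=r+1..s. p q) + Q s"
      unfolding Q_def by (simp only:) (rule sum.union_disjoint, auto)
    then show ?thesis
      by simp
  qed
  have Q_less: "Q s < Q r" if "s \<in> {1..<a}" "r \<in> {1..<s}" for r s
  proof -
    have "0 < (\<Sum>q=r+1..s. p q)"
      using that p_pos by (intro sum_pos) auto
    then show ?thesis
      using diff[OF that] by simp
  qed
  have ivl: "{1..a-1} = {1..<a}"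
    by auto
  note variance = branches_variance_records[OF p_pos p_sum Q_def]
  note sums = record_sums_closed_form[OF Q_pos Q_less_1 P_eq Q_less diff]
  have closed_form: "branches_variance a p (N + 3) =
        (\<Sum>s=1..<a. p s / P s * (1 - Q s ^ (N + 2)))
      - (\<Sum>s=1..<a. p s)
      - (\<Sum>s=1..<a. p s ^ 2 * Q s ^ 2 * ((1 - Q s ^ (2 * (N + 1))) / (1 - Q s ^ 2)))
      - 2 * (\<Sum>s=1..<a. \<Sum>r=1..<s.
               p s * p r * Q s * Q r * ((1 - (Q s * Q r) ^ (N + 1)) / (1 - Q s * Q r)))
      + 2 * (\<Sum>s=1..<a. p s * Q s / P s *
               (\<Sum>r=1..<s. p r / P r * (1 - Q s ^ N)))
      - 2 * (\<Sum>s=1..<a. p s * Q s *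
               (\<Sum>r=1..<s. p r * Q r / P r * (1 / (\<Sum>q=r+1..s. p q)) * (Q r ^ N - Q s ^ N)))
      - 2 * (\<Sum>s=1..<a. p s * Q s *
               (\<Sum>r=1..<a. p r / P r * Q r ^ 2 * ((1 - (Q s * Q r) ^ N) / (1 - Q s * Q r))))
      + 2 * (\<Sum>s=1..<a. p s / P s * Q s *
               (\<Sum>r=1..<a. p r / P r * Q r ^ (N + 2) * (1 - Q s ^ N)))" for N
  proof -
    have regroup: "A - B - (C + 2 * D) + 2 * (E - F) - 2 * (G - H) =
        A - B - C - 2 * D + 2 * E - 2 * F - 2 * G + 2 * H" for A B C D E F G H :: real
      by (simp add: algebra_simps)
    have "N + 3 - 1 = N + 2" "2 \<le> N + 3"
      by simp_all
    note variance[OF _ this(2), unfolded this(1)]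
    then show ?thesis
      by (simp only: sums regroup implies_True_equals True_implies_equals triv_forall_equality)
  qed
  show ?thesis
  proof (intro conjI allI impI)
    fix n :: nat assume "n \<ge> 2"
    then consider "n = 2" | N where "n = N + 3"
      using that(2)[of "n - 3"] by (cases "n = 2") auto
    then show "branches_variance a p n =
        (\<Sum>s=1..a-1. p s / P s * (1 - Q s ^ (n-1)))
      - (\<Sum>s=1..a-1. p s)
      - (\<Sum>s=1..a-1. p s ^ 2 * Q s ^ 2 * ((1 - Q s ^ (2*(n-2))) / (1 - Q s ^ 2)))
      - 2 * (\<Sum>s=2..a-1. \<Sum>r=1..s-1.
               p s * p r * Q s * Q r * ((1 - (Q s * Q r) ^ (n-2)) / (1 - Q s * Q r)))
      + 2 * (\<Sum>s=2..a-1. p s * Q s / P s *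
               (\<Sum>r=1..s-1. p r / P r * (1 - Q s powi (int n - 3))))
      - 2 * (\<Sum>s=2..a-1. p s * Q s *
               (\<Sum>r=1..s-1. p r * Q r / P r * (1 / (\<Sum>q=r+1..s. p q)) *
                  (Q r powi (int n - 3) - Q s powi (int n - 3))))
      - 2 * (\<Sum>s=1..a-1. p s * Q s *
               (\<Sum>r=1..a-1. p r / P r * Q r ^ 2 *
                  ((1 - (Q s * Q r) powi (int n - 3)) / (1 - Q s * Q r))))
      + 2 * (\<Sum>s=1..a-1. p s / P s * Q s *
               (\<Sum>r=1..a-1. p r / P r * Q r ^ (n-1) * (1 - Q s powi (int n - 3))))"
    proof cases
      case 1
      \<comment> \<open>The exponent \<open>n - 3\<close> is \<open>-1\<close> here. The tree has exactly one branch, and on the right-hand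
        side the first two sums cancel, the next two vanish, and the last four cancel in pairs.\<close>
      have powi: "x powi (int 2 - 3) = 1 / x" for x :: real
        by (simp add: power_int_def divide_inverse)
      have "branches_variance a p 2 = 0"
        using variance[of 2] by simp
      moreover have "(\<Sum>s=1..<a. p s / P s * (1 - Q s ^ (2 - 1))) = (\<Sum>s=1..<a. p s)"
      proof (intro sum.cong refl)
        fix s assume s: "s \<in> {1..<a}"
        show "p s / P s * (1 - Q s ^ (2 - 1)) = p s"
          using P_pos[OF s] P_eq[OF s] by simp
      qed
      moreover have "(\<Sum>s=1..<a. p s * Q s / P s * (\<Sum>r=1..<s. p r / P r * (1 - 1 / Q s))) =
          (\<Sum>s=1..<a. p s * Q s *
             (\<Sum>r=1..<s. p r * Q r / P r * (1 / (\<Sum>q=r+1..s. p q)) * (1 / Q r - 1 / Q s)))"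
        unfolding sum_distrib_left
      proof (intro sum.cong refl)
        fix s r assume s: "s \<in> {1..<a}" and r: "r \<in> {1..<s}"
        then have ra: "r \<in> {1..<a}"
          by auto
        have "p s * Q s / P s * (p r / P r * (1 - 1 / Q s)) = - (p s * p r / P r)"
          unfolding P_eq[OF s] using Q_pos[OF s] Q_less_1[OF s] P_pos[OF ra]
          by (simp add: divide_simps) (simp add: algebra_simps)
        also have "\<dots> = p s * Q s * (p r * Q r / P r * (1 / (Q r - Q s)) * (1 / Q r - 1 / Q s))"
          using Q_pos[OF s] Q_pos[OF ra] Q_less[OF s r] P_pos[OF ra]
          by (simp add: divide_simps) (simp add: algebra_simps)
        finally show "p s * Q s / P s * (p r / P r * (1 - 1 / Q s)) =
            p s * Q s * (p r * Q r / P r * (1 / (\<Sum>q=r+1..s. p q)) * (1 / Q r - 1 / Q s))"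
          unfolding diff[OF s r] .
      qed
      moreover have "(\<Sum>s=1..<a. p s * Q s *
            (\<Sum>r=1..<a. p r / P r * Q r ^ 2 * ((1 - 1 / (Q s * Q r)) / (1 - Q s * Q r)))) =
          (\<Sum>s=1..<a. p s / P s * Q s * (\<Sum>r=1..<a. p r / P r * Q r ^ (2 - 1) * (1 - 1 / Q s)))"
        unfolding sum_distrib_left
      proof (intro sum.cong refl)
        fix s r assume s: "s \<in> {1..<a}" and r: "r \<in> {1..<a}"
        have "Q s * Q r \<noteq> 1"
          using mult_strict_mono[of "Q s" 1 "Q r" 1] Q_less_1[OF s] Q_less_1[OF r] Q_pos[OF r]
          by simp
        then have "p s * Q s * (p r / P r * Q r ^ 2 * ((1 - 1 / (Q s * Q r)) / (1 - Q s * Q r))) =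
            - (p s * p r / P r * Q r)"
          using Q_pos[OF s] Q_pos[OF r] P_pos[OF r]
          by (simp add: divide_simps power2_eq_square) (simp add: algebra_simps)
        also have "\<dots> = p s / P s * Q s * (p r / P r * Q r ^ (2 - 1) * (1 - 1 / Q s))"
          unfolding P_eq[OF s] using Q_pos[OF s] Q_less_1[OF s] P_pos[OF r]
          by (simp add: divide_simps) (simp add: algebra_simps)
        finally show "p s * Q s * (p r / P r * Q r ^ 2 * ((1 - 1 / (Q s * Q r)) / (1 - Q s * Q r))) =
            p s / P s * Q s * (p r / P r * Q r ^ (2 - 1) * (1 - 1 / Q s))" .
      qed
      ultimately show ?thesis
        unfolding 1 powi ivl sum_ivl_drop_first by simp
    next
      case (2 N)
      have exps: "int n - 3 = int N" "n - 1 = N + 2" "n - 2 = N + 1"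
        using 2 by simp_all
      show ?thesis
        unfolding exps power_int_of_nat ivl sum_ivl_drop_first unfolding 2 by (rule closed_form)
    qed
  next
    have pow: "(\<lambda>N. Q s ^ (N + c)) \<longlonglongrightarrow> 0" if "s \<in> {1..<a}" for s c
      using Q_pos[OF that] Q_less_1[OF that]
      by (intro LIMSEQ_ignore_initial_segment LIMSEQ_realpow_zero) auto
    have pow_prod: "(\<lambda>N. (Q s * Q r) ^ (N + c)) \<longlonglongrightarrow> 0" if "s \<in> {1..<a}" "r \<in> {1..<a}" for s r c
    proof -
      have "Q s * Q r < 1"
        using mult_strict_mono[of "Q s" 1 "Q r" 1] Q_less_1 Q_pos that by (simp add: less_imp_le)
      then show ?thesis
        using Q_pos that by (intro LIMSEQ_ignore_initial_segment LIMSEQ_realpow_zero) (auto intro: less_imp_le)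
    qed
    have pow_even: "(\<lambda>N. Q s ^ (2 * (N + 1))) \<longlonglongrightarrow> 0" if "s \<in> {1..<a}" for s
      using pow_prod[OF that that, of 1] by (simp only: power_mult power2_eq_square)
    note pows = pow pow[where c = 0, simplified] pow_prod pow_prod[where c = 0, simplified] pow_even
    \<comment> \<open>Every power of some \<open>Q s\<close>, or of a product of two of them, is replaced by its limit \<open>0\<close>.\<close>
    have "(\<lambda>N. branches_variance a p (N + 3)) \<longlonglongrightarrow>
          (\<Sum>s=1..<a. p s / P s * (1 - 0))
        - (\<Sum>s=1..<a. p s)
        - (\<Sum>s=1..<a. p s ^ 2 * Q s ^ 2 * ((1 - 0) / (1 - Q s ^ 2)))
        - 2 * (\<Sum>s=1..<a. \<Sum>r=1..<s. p s * p r * Q s * Q r * ((1 - 0) / (1 - Q s * Q r)))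
        + 2 * (\<Sum>s=1..<a. p s * Q s / P s * (\<Sum>r=1..<s. p r / P r * (1 - 0)))
        - 2 * (\<Sum>s=1..<a. p s * Q s *
                 (\<Sum>r=1..<s. p r * Q r / P r * (1 / (\<Sum>q=r+1..s. p q)) * (0 - 0)))
        - 2 * (\<Sum>s=1..<a. p s * Q s *
                 (\<Sum>r=1..<a. p r / P r * Q r ^ 2 * ((1 - 0) / (1 - Q s * Q r))))
        + 2 * (\<Sum>s=1..<a. p s / P s * Q s * (\<Sum>r=1..<a. p r / P r * 0 * (1 - 0)))"
      \<comment> \<open>The denominators do not depend on \<open>N\<close>; as constant factors they are covered by \<open>tendsto_mult\<close>.\<close>
      unfolding closed_form divide_inverse[of "1 - _ ^ _"] divide_inverse[of "1 - 0"]
      by (intro tendsto_add tendsto_diff tendsto_mult tendsto_sum tendsto_const pows) auto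
    then have "(\<lambda>N. branches_variance a p (N + 3)) \<longlonglongrightarrow>
          (\<Sum>s=1..<a. p s / P s)
        - (\<Sum>s=1..<a. p s)
        - (\<Sum>s=1..<a. p s ^ 2 * Q s ^ 2 * (1 / (1 - Q s ^ 2)))
        - 2 * (\<Sum>s=1..<a. \<Sum>r=1..<s. p s * p r * Q s * Q r * (1 / (1 - Q s * Q r)))
        + 2 * (\<Sum>s=1..<a. p s * Q s / P s * (\<Sum>r=1..<s. p r / P r))
        - 2 * (\<Sum>s=1..<a. p s * Q s *
                 (\<Sum>r=1..<a. p r / P r * Q r ^ 2 * (1 / (1 - Q s * Q r))))"
      by (simp only: diff_zero diff_self mult_zero_right mult_zero_left mult_1_right sum.neutral_const add_0_right)
    then show "(\<lambda>n. branches_variance a p n) \<longlonglongrightarrow>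
        (\<Sum>s=1..a-1. p s / P s)
      - (\<Sum>s=1..a-1. p s)
      - (\<Sum>s=1..a-1. p s ^ 2 * Q s ^ 2 * (1 / (1 - Q s ^ 2)))
      - 2 * (\<Sum>s=2..a-1. \<Sum>r=1..s-1. p s * p r * Q s * Q r * (1 / (1 - Q s * Q r)))
      + 2 * (\<Sum>s=2..a-1. p s * Q s / P s * (\<Sum>r=1..s-1. p r / P r))
      - 2 * (\<Sum>s=1..a-1. p s * Q s *
               (\<Sum>r=1..a-1. p r / P r * Q r ^ 2 * (1 / (1 - Q s * Q r))))"
      unfolding ivl sum_ivl_drop_first by (rule LIMSEQ_offset)
  qed
qed

end
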